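(* For any $1\le\gamma=\gamma(n)\le\mathrm{poly}(n)$, there is an efficient (polynomial-time) reduction from $\gamma'$-GapSVP to $\gamma$-GapCVP$^{1/\gamma}$, where $\gamma'=\gamma\cdot(1+o(1))$.
   Context: $\gamma$-GapSVP: given a lattice $\mathcal{L}\subset\mathbb{Q}^n$ (by a basis) and $d>0$, YES if $\lambda_1(\mathcal{L})\le d$, NO if $\lambda_1(\mathcal{L})>\gamma d$, where $\lambda_1$ is the length of a shortest nonzero lattice vector. For $\gamma\ge1$, $\alpha>0$, $\gamma$-GapCVP$^{\alpha}$: given a lattice $\mathcal{L}\subset\mathbb{Q}^n$, a target $t\in\mathbb{Q}^n$ and $d>0$, YES if $\mathrm{dist}(t,\mathcal{L})\le d$, and NO if $\mathrm{dist}(kt,\mathcal{L})>\gamma d$ for all nonzero integers $k$ and $d<\alpha\lambda_1(\mathcal{L})$; $\mathrm{dist}$ is Euclidean distance. The reduction may make multiple oracle queries. *)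

theory Defs
  imports
    Complex_Main
    "HOL-Library.Landau_Symbols"
    "HOL-Library.Log_Nat"
    "HOL-Computational_Algebra.Polynomial"
    "Jordan_Normal_Form.Matrix"
begin

section \<open>Lattices\<close>

definition euclid_norm :: "rat vec \<Rightarrow> real" where
  "euclid_norm v = sqrt (of_rat (v \<bullet> v))"

text \<open>A basis is a matrix \<open>B\<close> whose columns are the basis vectors: \<open>dim_row B\<close> is the dimension
  of the ambient space and \<open>dim_col B\<close> the rank of the lattice. The zero lattice is excluded.\<close>

definition is_lattice_basis :: "rat mat \<Rightarrow> bool" where
  "is_lattice_basis B \<longleftrightarrow> 0 < dim_col B \<and>
     (\<forall>x \<in> carrier_vec (dim_col B). B *\<^sub>v x = 0\<^sub>v (dim_row B) \<longrightarrow> x = 0\<^sub>v (dim_col B))"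

definition lattice_of :: "rat mat \<Rightarrow> rat vec set" where
  "lattice_of B = {B *\<^sub>v map_vec of_int z | z :: int vec. z \<in> carrier_vec (dim_col B)}"

definition lambda1 :: "rat vec set \<Rightarrow> real" where
  "lambda1 L = Inf {euclid_norm v | v. v \<in> L \<and> v \<noteq> 0\<^sub>v (dim_vec v)}"

definition lattice_dist :: "rat vec \<Rightarrow> rat vec set \<Rightarrow> real" where
  "lattice_dist t L = Inf {euclid_norm (t - v) | v. v \<in> L}"


section \<open>Promise problems on words of integers\<close>

type_synonym word = "int list"

type_synonym promise_problem = "word set \<times> word set"

definition yes_instances :: "promise_problem \<Rightarrow> word set" where
  "yes_instances P = fst P"

definition no_instances :: "promise_problem \<Rightarrow> word set" where
  "no_instances P = snd P"

text \<open>A rational is written as a numerator and a positive denominator, not necessarily coprime.\<close>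

definition encodes_rats :: "word \<Rightarrow> rat list \<Rightarrow> bool" where
  "encodes_rats w qs \<longleftrightarrow> (\<exists>ps :: (int \<times> int) list.
     (\<forall>(a, b) \<in> set ps. 0 < b) \<and>
     qs = map (\<lambda>(a, b). of_int a / of_int b) ps \<and>
     w = concat (map (\<lambda>(a, b). [a, b]) ps))"

definition basis_entries :: "rat mat \<Rightarrow> rat list" where
  "basis_entries B = concat (map list_of_vec (cols B))"

definition encodes_svp :: "word \<Rightarrow> rat mat \<Rightarrow> rat \<Rightarrow> bool" where
  "encodes_svp w B d \<longleftrightarrow> (\<exists>u. w = int (dim_row B) # int (dim_col B) # u \<and>
     encodes_rats u (d # basis_entries B))"

definition encodes_cvp :: "word \<Rightarrow> rat mat \<Rightarrow> rat vec \<Rightarrow> rat \<Rightarrow> bool" where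
  "encodes_cvp w B t d \<longleftrightarrow> (\<exists>u. w = int (dim_row B) # int (dim_col B) # u \<and>
     encodes_rats u (d # list_of_vec t @ basis_entries B))"

text \<open>The approximation factors are functions of the rank of the lattice.\<close>

definition GapSVP :: "(nat \<Rightarrow> real) \<Rightarrow> promise_problem" where
  "GapSVP \<gamma> =
    ({w. \<exists>B d. encodes_svp w B d \<and> is_lattice_basis B \<and> 0 < d \<and>
        lambda1 (lattice_of B) \<le> of_rat d},
     {w. \<exists>B d. encodes_svp w B d \<and> is_lattice_basis B \<and> 0 < d \<and>
        lambda1 (lattice_of B) > \<gamma> (dim_col B) * of_rat d})"

definition GapCVP :: "(nat \<Rightarrow> real) \<Rightarrow> (nat \<Rightarrow> real) \<Rightarrow> promise_problem" where
  "GapCVP \<alpha> \<gamma> =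
    ({w. \<exists>B t d. encodes_cvp w B t d \<and> is_lattice_basis B \<and> t \<in> carrier_vec (dim_row B) \<and> 0 < d \<and>
        lattice_dist t (lattice_of B) \<le> of_rat d},
     {w. \<exists>B t d. encodes_cvp w B t d \<and> is_lattice_basis B \<and> t \<in> carrier_vec (dim_row B) \<and> 0 < d \<and>
        (\<forall>k :: int. k \<noteq> 0 \<longrightarrow>
           lattice_dist (of_int k \<cdot>\<^sub>v t) (lattice_of B) > \<gamma> (dim_col B) * of_rat d) \<and>
        of_rat d < \<alpha> (dim_col B) * lambda1 (lattice_of B)})"


section \<open>Oracle random access machines with logarithmic cost\<close>

text \<open>A random access machine with integer registers, which are addressed by constants of the
  program, and an integer memory, which is addressed through registers. Every step is charged by
  the bit lengths of all the integers it handles, addresses included; a query is charged by the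
  bit length of the queried word. Up to a polynomial, this is time on an oracle Turing machine.\<close>

type_synonym oracle_fun = "word \<Rightarrow> bool"

datatype arith_op = Add | Sub | Mul | Div

fun apply_op :: "arith_op \<Rightarrow> int \<Rightarrow> int \<Rightarrow> int" where
  "apply_op Add a b = a + b"
| "apply_op Sub a b = a - b"
| "apply_op Mul a b = a * b"
| "apply_op Div a b = a div b"

type_synonym reg = nat

datatype com =
    Skip
  | Const reg int
  | Arith arith_op reg reg reg
  | Load reg reg
  | Store reg reg
  | Query reg reg reg
  | Seq com com
  | IfPos reg com com
  | WhilePos reg com

type_synonym state = "(reg \<Rightarrow> int) \<times> (int \<Rightarrow> int)"

definition int_size :: "int \<Rightarrow> nat" where
  "int_size z = 1 + floorlog 2 (nat \<bar>z\<bar>)"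

definition word_size :: "word \<Rightarrow> nat" where
  "word_size w = (\<Sum>z\<leftarrow>w. int_size z)"

definition read_word :: "(int \<Rightarrow> int) \<Rightarrow> int \<Rightarrow> int \<Rightarrow> word" where
  "read_word M a l = map (\<lambda>i. M (a + int i)) [0..<nat l]"

text \<open>\<open>exec Q c s T s'\<close>: with oracle \<open>Q\<close>, the program \<open>c\<close> started in state \<open>s\<close> halts in state \<open>s'\<close>
  after time \<open>T\<close>.\<close>

inductive exec :: "oracle_fun \<Rightarrow> com \<Rightarrow> state \<Rightarrow> nat \<Rightarrow> state \<Rightarrow> bool" for Q where
  Skip: "exec Q Skip s 1 s"
| Const: "exec Q (Const r z) (R, M) (1 + int_size z) (R(r := z), M)"
| Arith: "exec Q (Arith f r a b) (R, M) (1 + int_size (R a) + int_size (R b))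
            (R(r := apply_op f (R a) (R b)), M)"
| Load: "exec Q (Load r a) (R, M) (1 + int_size (R a) + int_size (M (R a))) (R(r := M (R a)), M)"
| Store: "exec Q (Store a r) (R, M) (1 + int_size (R a) + int_size (R r)) (R, M(R a := R r))"
| Query: "w = read_word M (R a) (R l) \<Longrightarrow>
    exec Q (Query r a l) (R, M) (1 + int_size (R a) + int_size (R l) + word_size w)
      (R(r := if Q w then 1 else 0), M)"
| Seq: "exec Q c1 s T1 s' \<Longrightarrow> exec Q c2 s' T2 s'' \<Longrightarrow> exec Q (Seq c1 c2) s (T1 + T2) s''"
| IfTrue: "R r > 0 \<Longrightarrow> exec Q c1 (R, M) T s' \<Longrightarrow>
    exec Q (IfPos r c1 c2) (R, M) (1 + int_size (R r) + T) s'"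
| IfFalse: "\<not> R r > 0 \<Longrightarrow> exec Q c2 (R, M) T s' \<Longrightarrow>
    exec Q (IfPos r c1 c2) (R, M) (1 + int_size (R r) + T) s'"
| WhileTrue: "R r > 0 \<Longrightarrow> exec Q c (R, M) T1 s' \<Longrightarrow> exec Q (WhilePos r c) s' T2 s'' \<Longrightarrow>
    exec Q (WhilePos r c) (R, M) (1 + int_size (R r) + T1 + T2) s''"
| WhileFalse: "\<not> R r > 0 \<Longrightarrow> exec Q (WhilePos r c) (R, M) (1 + int_size (R r)) (R, M)"

inductive_cases exec_elims:
  "exec Q Skip s T s'"
  "exec Q (Const r z) s T s'"
  "exec Q (Arith f r a b) s T s'"
  "exec Q (Load r a) s T s'"
  "exec Q (Store a r) s T s'"
  "exec Q (Query r a l) s T s'"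
  "exec Q (Seq c1 c2) s T s'"
  "exec Q (IfPos r c1 c2) s T s'"
  "exec Q (WhilePos r c) s T s'"

lemma exec_deterministic:
  "exec Q c s T1 s1 \<Longrightarrow> exec Q c s T2 s2 \<Longrightarrow> T2 = T1 \<and> s2 = s1"
proof (induction arbitrary: T2 s2 rule: exec.induct)
  case (Seq c1 s Ta s' c2 Tb s'')
  from Seq.prems obtain Ua u Ub where u: "T2 = Ua + Ub" "exec Q c1 s Ua u" "exec Q c2 u Ub s2"
    by (rule exec_elims(7))
  from Seq.IH(1)[OF u(2)] have "Ua = Ta" "u = s'" by simp_all
  with Seq.IH(2)[of Ub s2] u(1,3) show ?case by simp
next
  case (IfTrue R r c1 M T s' c2)
  from IfTrue.prems IfTrue.hyps(1) obtain U where
    u: "T2 = 1 + int_size (R r) + U" "exec Q c1 (R, M) U s2"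
    by (auto elim: exec_elims(8))
  from IfTrue.IH[OF u(2)] u(1) show ?case by simp
next
  case (IfFalse R r c2 M T s' c1)
  from IfFalse.prems IfFalse.hyps(1) obtain U where
    u: "T2 = 1 + int_size (R r) + U" "exec Q c2 (R, M) U s2"
    by (auto elim: exec_elims(8))
  from IfFalse.IH[OF u(2)] u(1) show ?case by simp
next
  case (WhileTrue R r c M Ta s' Tb s'')
  note IH = WhileTrue.IH and pos = WhileTrue.hyps(1)
  from WhileTrue.prems show ?case
  proof (cases rule: exec.cases)
    case (WhileTrue Ua u Ub)
    from IH(1)[OF WhileTrue(3)] have "Ua = Ta" "u = s'" by simp_all
    with IH(2)[of Ub s2] WhileTrue(1,4) show ?thesis by simp
  qed (use pos in simp)
next
  case (WhileFalse R r c M)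
  from WhileFalse.prems show ?case
    by (cases rule: exec.cases) (use WhileFalse.hyps in simp_all)
qed (auto elim: exec_elims(1-6))

text \<open>The input is stored in the memory cells from address 0 on and its length in register 0;
  the machine accepts by halting with a positive value in register 0.\<close>

definition initial_state :: "word \<Rightarrow> state" where
  "initial_state w = ((\<lambda>_. 0)(0 := int (length w)),
     (\<lambda>a. if 0 \<le> a \<and> a < int (length w) then w ! nat a else 0))"

definition accepts :: "oracle_fun \<Rightarrow> com \<Rightarrow> word \<Rightarrow> bool" where
  "accepts Q c w \<longleftrightarrow> (\<exists>T R M. exec Q c (initial_state w) T (R, M) \<and> R 0 > 0)"

definition poly_time :: "com \<Rightarrow> bool" where
  "poly_time c \<longleftrightarrow> (\<exists>p :: nat poly. \<forall>Q w. \<exists>T s.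
     exec Q c (initial_state w) T s \<and> T \<le> poly p (word_size w))"

definition oracle_solves :: "oracle_fun \<Rightarrow> promise_problem \<Rightarrow> bool" where
  "oracle_solves Q P \<longleftrightarrow> (\<forall>w \<in> yes_instances P. Q w) \<and> (\<forall>w \<in> no_instances P. \<not> Q w)"

text \<open>Cook reductions between promise problems: the oracle may answer arbitrarily on queries
  outside of the promise.\<close>

definition poly_time_reducible :: "promise_problem \<Rightarrow> promise_problem \<Rightarrow> bool" where
  "poly_time_reducible P P' \<longleftrightarrow> (\<exists>c. poly_time c \<and>
     (\<forall>Q. oracle_solves Q P' \<longrightarrow> oracle_solves (accepts Q c) P))"

end

theory Submission
  imports Defs
begin

text \<open>
  Let \<open>b\<^sub>1, \<dots>, b\<^sub>n\<close> be the basis and \<open>q\<close> a power of two with \<open>q > (n + 1) \<gamma>(n)\<close>. For every \<open>i\<close> and every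
  odd \<open>j < q\<close>, ask the oracle about the lattice generated by \<open>b\<^sub>1, \<dots>, q b\<^sub>i, \<dots>, b\<^sub>n\<close>, the target
  \<open>(j b\<^sub>i, d/n)\<close>, which has one more coordinate, and the distance \<open>d (1 + 1/n)\<close>; accept if some
  answer is positive. A shortest vector has an odd coefficient, at some \<open>b\<^sub>i\<close>, and with \<open>j\<close> its residue
  modulo \<open>q\<close> the vector shows that the target is close. If there are no short vectors, then a multiple
  \<open>k t\<close> of a target is far from the lattice: for \<open>q dvd k\<close> because of the last coordinate, which is at least
  \<open>q d/n\<close>, and otherwise because the difference to a lattice vector projects to a nonzero vector of the
  original lattice. Since \<open>\<gamma>\<close> is polynomially bounded, so is \<open>q\<close>, hence the number of queries; no value
  of \<open>\<gamma>\<close> is ever computed.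
\<close>

section \<open>Shortest lattice vectors\<close>

text \<open>The difficulty is the NO side, where all nonzero multiples of the target have to be far
  at once. In the space of the given lattice this is impossible, since \<open>q\<close> times
  \<open>j b_i\<close> is a vector of the new lattice. The extra coordinate \<open>s\<close> repels
  exactly these multiples, and it costs at most an additive \<open>s\<close> in the distance of the
  close target. Two demands fix \<open>s\<close>: the loss \<open>1 + s/d\<close> has to be
  \<open>1 + o(1)\<close>, and \<open>q s\<close> has to exceed \<open>\<gamma>\<close> times the
  queried distance \<open>d + s\<close>. With \<open>s = d/n\<close> the loss is
  \<open>1 + 1/n\<close> and the second demand becomes the bound on \<open>q\<close>. That
  \<open>q\<close> is a power of two serves both sides: halving is what produces an odd coefficient,
  and the odd residues are exactly the units modulo \<open>q\<close>, so \<open>k j\<close> is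
  divisible by \<open>q\<close> only if \<open>k\<close> is. The new lattice is a sublattice of the
  old one up to a zero coordinate. Hence its shortest vectors are not shorter, and the promise
  relating the queried distance to \<open>1/\<gamma>\<close> times their length comes for
  free.\<close>

lemma scalar_prod_self_nonneg: "0 \<le> (v :: rat vec) \<bullet> v"
  unfolding scalar_prod_def by (intro sum_nonneg) simp

lemma euclid_norm_nonneg: "0 \<le> euclid_norm v"
  unfolding euclid_norm_def using scalar_prod_self_nonneg[of v] by simp

lemma euclid_norm_smult: "euclid_norm (a \<cdot>\<^sub>v v) = \<bar>of_rat a\<bar> * euclid_norm v"
proof -
  have "(a \<cdot>\<^sub>v v) \<bullet> (a \<cdot>\<^sub>v v) = a\<^sup>2 * (v \<bullet> v)"
    by (simp add: scalar_prod_def sum_distrib_left power2_eq_square mult_ac)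
  then show ?thesis
    by (simp add: euclid_norm_def of_rat_mult of_rat_power real_sqrt_mult)
qed

lemma euclid_norm_pos:
  assumes "v \<noteq> 0\<^sub>v (dim_vec v)"
  shows "0 < euclid_norm v"
proof -
  obtain r where r: "r < dim_vec v" "v $ r \<noteq> 0"
    using assms by (metis eq_vecI index_zero_vec)
  have "0 < v \<bullet> v"
    unfolding scalar_prod_def
    by (rule sum_pos2[where i = r]) (use r in \<open>auto simp: zero_less_mult_iff\<close>)
  then show ?thesis by (simp add: euclid_norm_def)
qed

section \<open>Infima over the lattice, and why the shortest length is attained\<close>

lemma lambda1_le_norm:
  assumes "v \<in> L" "v \<noteq> 0\<^sub>v (dim_vec v)"
  shows "lambda1 L \<le> euclid_norm v"
  unfolding lambda1_def
  by (rule cInf_lower) (use assms euclid_norm_nonneg in \<open>auto intro!: bdd_belowI[where m = 0]\<close>)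

lemma lattice_dist_le_norm:
  assumes "v \<in> L"
  shows "lattice_dist t L \<le> euclid_norm (t - v)"
  unfolding lattice_dist_def
  by (rule cInf_lower) (use assms euclid_norm_nonneg in \<open>auto intro!: bdd_belowI[where m = 0]\<close>)

text \<open>Serves to scale the squared norms of lattice vectors to natural numbers, among which a
  least one exists.\<close>

lemma finite_rats_common_denominator:
  assumes "finite (F :: rat set)"
  shows "\<exists>D :: int. 0 < D \<and> (\<forall>x \<in> F. of_int D * x \<in> \<int>)"
  using assms
proof (induction F)
  case empty
  show ?case by (intro exI[of _ 1]) simp
next
  case (insert x F)
  then obtain D :: int where D: "0 < D" "\<forall>x \<in> F. of_int D * x \<in> \<int>" by blast
  obtain a b where x: "x = of_int a / of_int b" "0 < b"
    by (metis quotient_of_denom_pos quotient_of_div surj_pair)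
  have "of_int (D * b) * x = of_int (D * a)" using x by simp
  then have "of_int (D * b) * x \<in> \<int>" by (metis Ints_of_int)
  moreover have "of_int (D * b) * y \<in> \<int>" if "y \<in> F" for y
  proof -
    have "of_int (D * b) * y = of_int b * (of_int D * y)" by simp
    then show ?thesis using D that by (metis Ints_mult Ints_of_int)
  qed
  ultimately show ?case using D x by (intro exI[of _ "D * b"]) auto
qed

lemma mult_mat_vec_nonzero:
  assumes "is_lattice_basis B" "x \<in> carrier_vec (dim_col B)" "x \<noteq> 0\<^sub>v (dim_col B)"
  shows "B *\<^sub>v x \<noteq> 0\<^sub>v (dim_vec (B *\<^sub>v x))"
  using assms by (auto simp: is_lattice_basis_def)

lemma map_vec_of_int_eq_zero_iff:
  assumes "z \<in> carrier_vec n"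
  shows "map_vec of_int z = (0\<^sub>v n :: rat vec) \<longleftrightarrow> z = 0\<^sub>v n"
  using assms by (auto simp: vec_eq_iff)

text \<open>The infimum is a minimum by well-ordering: for a common denominator \<open>D\<close> of
  the entries of \<open>B\<close>, \<open>D\<^sup>2\<close> times a squared norm is a natural
  number, and a nonzero coefficient vector with the least such number is the witness.\<close>

lemma lambda1_attained:
  assumes B: "is_lattice_basis B"
  obtains z where "z \<in> carrier_vec (dim_col B)" "z \<noteq> 0\<^sub>v (dim_col B)"
    "euclid_norm (B *\<^sub>v map_vec of_int z) = lambda1 (lattice_of B)"
proof -
  define n where "n = dim_col B"
  define m where "m = dim_row B"
  let ?P = "\<lambda>z :: int vec. z \<in> carrier_vec n \<and> z \<noteq> 0\<^sub>v n"
  let ?v = "\<lambda>z :: int vec. B *\<^sub>v map_vec of_int z"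
  have "0 < n" using B by (simp add: is_lattice_basis_def n_def)
  have ex: "?P (unit_vec n 0)"
    using \<open>0 < n\<close> by (auto simp: vec_eq_iff)
  obtain D :: int where D: "0 < D" "\<forall>x \<in> elements_mat B. of_int D * x \<in> \<int>"
  proof -
    have "elements_mat B = (\<lambda>(r, c). B $$ (r, c)) ` ({..<m} \<times> {..<n})"
      by (auto simp: elements_mat_def m_def n_def)
    then have "finite (elements_mat B)" by simp
    from finite_rats_common_denominator[OF this] that show thesis by blast
  qed
  have int_coord: "of_int D * (?v z $ r) \<in> \<int>" if "?P z" "r < m" for z r
  proof -
    have "of_int D * (?v z $ r) = (\<Sum>c = 0..<n. of_int D * B $$ (r, c) * of_int (z $ c))"
      using that by (auto simp: m_def n_def scalar_prod_def sum_distrib_left mult_ac)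
    also have "\<dots> \<in> \<int>"
      using that D
      by (intro Ints_sum Ints_mult[OF _ Ints_of_int]) (auto simp: m_def n_def elements_mat_def)
    finally show ?thesis .
  qed
  have int_norm: "\<exists>N :: nat. of_int (D\<^sup>2) * (?v z \<bullet> ?v z) = of_nat N" if "?P z" for z
  proof -
    have "of_int (D\<^sup>2) * (?v z \<bullet> ?v z) =
        (\<Sum>r = 0..<m. (of_int D * (?v z $ r)) * (of_int D * (?v z $ r)))"
      by (simp add: scalar_prod_def[of "?v z"] sum_distrib_left power2_eq_square mult_ac m_def
          del: index_mult_mat_vec)
    also have "\<dots> \<in> \<int>"
      by (intro Ints_sum Ints_mult[OF int_coord[OF that] int_coord[OF that]]) auto
    finally have "of_int (D\<^sup>2) * (?v z \<bullet> ?v z) \<in> \<int>" .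
    moreover have "0 \<le> of_int (D\<^sup>2) * (?v z \<bullet> ?v z)"
      using scalar_prod_self_nonneg[of "?v z"] by simp
    ultimately show ?thesis
      by (metis Ints_cases nonneg_int_cases of_int_0_le_iff of_int_of_nat_eq)
  qed
  then obtain N where N: "\<And>z. ?P z \<Longrightarrow> of_int (D\<^sup>2) * (?v z \<bullet> ?v z) = of_nat (N z)"
    by metis
  obtain z where z: "?P z" and min: "\<And>y. ?P y \<Longrightarrow> N z \<le> N y"
    using ex_has_least_nat[of ?P "unit_vec n 0" N] ex by blast
  have le: "euclid_norm (?v z) \<le> euclid_norm (?v y)" if "?P y" for y
  proof -
    have "of_int (D\<^sup>2) * (?v z \<bullet> ?v z) \<le> of_int (D\<^sup>2) * (?v y \<bullet> ?v y)"
      using min[OF that] N[OF z] N[OF that] by simp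
    then have "?v z \<bullet> ?v z \<le> ?v y \<bullet> ?v y" using D by simp
    then show ?thesis by (simp add: euclid_norm_def of_rat_less_eq)
  qed
  have "lambda1 (lattice_of B) = euclid_norm (?v z)"
    unfolding lambda1_def
  proof (rule cInf_eq_minimum)
    have "?v z \<noteq> 0\<^sub>v (dim_vec (?v z))"
      using z by (intro mult_mat_vec_nonzero[OF B]) (auto simp: n_def map_vec_of_int_eq_zero_iff)
    then show "euclid_norm (?v z) \<in>
        {euclid_norm v |v. v \<in> lattice_of B \<and> v \<noteq> 0\<^sub>v (dim_vec v)}"
      using z by (auto simp: lattice_of_def n_def)
  next
    fix l assume "l \<in> {euclid_norm v |v. v \<in> lattice_of B \<and> v \<noteq> 0\<^sub>v (dim_vec v)}"
    then obtain y where y: "y \<in> carrier_vec n" "l = euclid_norm (?v y)" "?v y \<noteq> 0\<^sub>v (dim_vec (?v y))"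
      by (auto simp: lattice_of_def n_def)
    have "y \<noteq> 0\<^sub>v n"
    proof
      assume "y = 0\<^sub>v n"
      then have "?v y = 0\<^sub>v (dim_vec (?v y))"
        by (intro eq_vecI) (auto simp: scalar_prod_def n_def)
      with y show False by simp
    qed
    with le y show "euclid_norm (?v z) \<le> l" by blast
  qed
  with that z show thesis unfolding n_def by metis
qed

text \<open>If all coefficients of a shortest vector were even, half of it would be a shorter one.\<close>

lemma shortest_vector_odd_coefficient:
  assumes B: "is_lattice_basis B" and z: "z \<in> carrier_vec (dim_col B)" "z \<noteq> 0\<^sub>v (dim_col B)"
    and short: "euclid_norm (B *\<^sub>v map_vec of_int z) = lambda1 (lattice_of B)"
  shows "\<exists>i < dim_col B. odd (z $ i)"
proof (rule ccontr)
  assume "\<not> ?thesis"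
  then have ev: "even (z $ i)" if "i < dim_col B" for i using that by blast
  define y where "y = map_vec (\<lambda>a. a div 2) z"
  have y: "y \<in> carrier_vec (dim_col B)" using z by (simp add: y_def)
  have zy: "map_vec of_int z = (2 :: rat) \<cdot>\<^sub>v map_vec of_int y"
  proof (intro eq_vecI)
    fix i assume "i < dim_vec ((2 :: rat) \<cdot>\<^sub>v map_vec of_int y)"
    then have i: "i < dim_col B" using z by (simp add: y_def)
    then have "z $ i = 2 * (z $ i div 2)" using ev[OF i] by simp
    then have "of_int (z $ i) = (2 :: rat) * of_int (z $ i div 2)"
      by (metis of_int_mult of_int_numeral)
    then show "map_vec of_int z $ i = ((2 :: rat) \<cdot>\<^sub>v map_vec of_int y) $ i"
      using i z by (simp add: y_def)
  qed (use z in \<open>simp add: y_def\<close>)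
  let ?v = "B *\<^sub>v map_vec of_int y"
  have "B *\<^sub>v map_vec of_int z = 2 \<cdot>\<^sub>v ?v"
    unfolding zy by (rule mult_mat_vec[OF carrier_matI]) (use y in auto)
  then have "lambda1 (lattice_of B) = 2 * euclid_norm ?v"
    using short by (simp add: euclid_norm_smult)
  moreover have "map_vec of_int y \<noteq> (0\<^sub>v (dim_col B) :: rat vec)"
  proof
    assume y0: "map_vec of_int y = (0\<^sub>v (dim_col B) :: rat vec)"
    have "map_vec of_int z = (0\<^sub>v (dim_col B) :: rat vec)" unfolding zy y0 by auto
    with z show False by (simp add: map_vec_of_int_eq_zero_iff)
  qed
  then have nz: "?v \<noteq> 0\<^sub>v (dim_vec ?v)"
    using y by (intro mult_mat_vec_nonzero[OF B]) auto
  moreover have "lambda1 (lattice_of B) \<le> euclid_norm ?v"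
    by (rule lambda1_le_norm[OF _ nz]) (use y in \<open>auto simp: lattice_of_def\<close>)
  ultimately show False using euclid_norm_pos[OF nz] by linarith
qed


section \<open>Sparsified lattices and targets\<close>

definition extend_vec :: "rat vec \<Rightarrow> rat \<Rightarrow> rat vec" where
  "extend_vec v x = vec (Suc (dim_vec v)) (\<lambda>r. if r < dim_vec v then v $ r else x)"

text \<open>The zero bottom row leaves all lattice vectors in the original space, so no lattice
  vector can cancel the last coordinate of a multiple of the target.\<close>

definition sparse_basis :: "rat mat \<Rightarrow> nat \<Rightarrow> nat \<Rightarrow> rat mat" where
  "sparse_basis B i q = mat (Suc (dim_row B)) (dim_col B)
     (\<lambda>(r, c). if r < dim_row B then (if c = i then of_nat q else 1) * B $$ (r, c) else 0)"

definition sparse_target :: "rat mat \<Rightarrow> nat \<Rightarrow> nat \<Rightarrow> rat \<Rightarrow> rat vec" where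
  "sparse_target B i j s = extend_vec (of_nat j \<cdot>\<^sub>v col B i) s"

lemma euclid_norm_extend_vec:
  "euclid_norm (extend_vec v x) = sqrt ((euclid_norm v)\<^sup>2 + (of_rat x)\<^sup>2)"
proof -
  have "extend_vec v x \<bullet> extend_vec v x = v \<bullet> v + x\<^sup>2"
    by (simp add: extend_vec_def scalar_prod_def power2_eq_square)
  then show ?thesis
    using scalar_prod_self_nonneg[of v] by (simp add: euclid_norm_def of_rat_add of_rat_power)
qed

lemma euclid_norm_extend_vec_ge:
  "euclid_norm v \<le> euclid_norm (extend_vec v x)" "\<bar>of_rat x\<bar> \<le> euclid_norm (extend_vec v x)"
  using real_sqrt_ge_abs1[of "euclid_norm v" "of_rat x"] real_sqrt_ge_abs2[of "of_rat x" "euclid_norm v"]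
  unfolding euclid_norm_extend_vec by (auto simp: euclid_norm_nonneg)

text \<open>The additive bound keeps the queried distance rational; the exact root of a sum of two
  squares would in general be irrational.\<close>

lemma euclid_norm_extend_vec_le: "euclid_norm (extend_vec v x) \<le> euclid_norm v + \<bar>of_rat x\<bar>"
  using sqrt_sum_squares_le_sum_abs[of "euclid_norm v" "of_rat x"] euclid_norm_nonneg[of v]
  by (simp add: euclid_norm_extend_vec)

lemma extend_vec_eq_zero: "extend_vec v 0 = 0\<^sub>v (Suc (dim_vec v)) \<longleftrightarrow> v = 0\<^sub>v (dim_vec v)"
  by (auto simp: extend_vec_def vec_eq_iff less_Suc_eq)

text \<open>The factor \<open>q\<close> moves from the \<open>i\<close>-th column to the
  \<open>i\<close>-th coefficient. For integral \<open>x\<close> this exhibits the sparse lattice as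
  the vectors of the old one with \<open>i\<close>-th coefficient divisible by \<open>q\<close>,
  with a zero appended.\<close>

lemma sparse_basis_mult_vec:
  assumes "x \<in> carrier_vec (dim_col B)"
  shows "sparse_basis B i q *\<^sub>v x =
    extend_vec (B *\<^sub>v vec (dim_col B) (\<lambda>c. (if c = i then of_nat q else 1) * x $ c)) 0"
  using assms
  by (intro eq_vecI)
    (auto simp: sparse_basis_def extend_vec_def scalar_prod_def intro!: sum.cong sum.neutral)

lemma is_lattice_basis_sparse_basis:
  assumes B: "is_lattice_basis B" and q: "0 < q"
  shows "is_lattice_basis (sparse_basis B i q)"
proof -
  have "x = 0\<^sub>v (dim_col B)"
    if x: "x \<in> carrier_vec (dim_col B)"
      and 0: "sparse_basis B i q *\<^sub>v x = 0\<^sub>v (Suc (dim_row B))" for x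
  proof -
    let ?y = "vec (dim_col B) (\<lambda>c. (if c = i then of_nat q else 1) * x $ c)"
    have "B *\<^sub>v ?y = 0\<^sub>v (dim_row B)"
      using 0 extend_vec_eq_zero[of "B *\<^sub>v ?y"] by (simp add: sparse_basis_mult_vec[OF x])
    then have "?y = 0\<^sub>v (dim_col B)" using B by (simp add: is_lattice_basis_def)
    then show ?thesis using x q by (auto simp: vec_eq_iff split: if_splits)
  qed
  with B show ?thesis by (auto simp: is_lattice_basis_def sparse_basis_def)
qed

text \<open>Both directions are read off from this identity: the \<open>i\<close>-th coefficient of
  the difference is congruent to \<open>k * j\<close> modulo \<open>q\<close>, the others can be any
  integers, and the last coordinate depends on \<open>k\<close> and \<open>s\<close> alone.\<close>

lemma sparse_difference:
  assumes z: "z \<in> carrier_vec (dim_col B)" and i: "i < dim_col B"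
  shows "of_int k \<cdot>\<^sub>v sparse_target B i j s - sparse_basis B i q *\<^sub>v map_vec of_int z =
    extend_vec (B *\<^sub>v map_vec of_int
      (vec (dim_col B) (\<lambda>c. if c = i then k * int j - int q * z $ c else - z $ c))) (of_int k * s)"
    (is "?l = extend_vec (B *\<^sub>v map_vec of_int ?y) _")
proof (rule eq_vecI)
  fix r assume "r < dim_vec (extend_vec (B *\<^sub>v map_vec of_int ?y) (of_int k * s))"
  then consider "r < dim_row B" | "r = dim_row B" by (auto simp: extend_vec_def less_Suc_eq)
  then show "?l $ r = extend_vec (B *\<^sub>v map_vec of_int ?y) (of_int k * s) $ r"
  proof cases
    case 1
    have "?l $ r = of_int k * (of_nat j * B $$ (r, i)) -
        (\<Sum>c = 0..<dim_col B. (if c = i then of_nat q else 1) * B $$ (r, c) * of_int (z $ c))"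
      using 1 z i by (simp add: sparse_basis_def sparse_target_def extend_vec_def scalar_prod_def)
    \<comment> \<open>The single entry of column \<open>i\<close> is spread to a sum over all
      columns, so that the two sums subtract termwise.\<close>
    also have "of_int k * (of_nat j * B $$ (r, i)) =
        (\<Sum>c = 0..<dim_col B. if c = i then of_int k * (of_nat j * B $$ (r, c)) else 0)"
      using i by simp
    also have "\<dots> - (\<Sum>c = 0..<dim_col B. (if c = i then of_nat q else 1) * B $$ (r, c) * of_int (z $ c))
        = (\<Sum>c = 0..<dim_col B. B $$ (r, c) * of_int (?y $ c))"
      unfolding sum_subtractf[symmetric] by (intro sum.cong) (auto simp: algebra_simps)
    also have "\<dots> = extend_vec (B *\<^sub>v map_vec of_int ?y) (of_int k * s) $ r"
      using 1 by (simp add: extend_vec_def scalar_prod_def)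
    finally show ?thesis .
  next
    case 2
    then show ?thesis
      using z by (simp add: sparse_basis_def sparse_target_def extend_vec_def scalar_prod_def)
  qed
qed (simp add: extend_vec_def sparse_basis_def)

text \<open>A shortest vector of the sparse lattice is a nonzero vector of the old one with a zero
  appended. This supplies the bound on the distance in the NO promise of the queries.\<close>

lemma lambda1_sparse_basis_ge:
  assumes B: "is_lattice_basis B" and q: "0 < q"
  shows "lambda1 (lattice_of B) \<le> lambda1 (lattice_of (sparse_basis B i q))"
proof -
  let ?B' = "sparse_basis B i q"
  have dim [simp]: "dim_col ?B' = dim_col B" by (simp add: sparse_basis_def)
  obtain z where z: "z \<in> carrier_vec (dim_col B)" "z \<noteq> 0\<^sub>v (dim_col B)"
    and norm: "euclid_norm (?B' *\<^sub>v map_vec of_int z) = lambda1 (lattice_of ?B')"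
    using lambda1_attained[OF is_lattice_basis_sparse_basis[OF B q, of i]] by auto
  let ?y = "vec (dim_col B) (\<lambda>c. (if c = i then int q else 1) * z $ c)"
  have "?B' *\<^sub>v map_vec of_int z = extend_vec (B *\<^sub>v map_vec of_int ?y) 0"
  proof -
    have "vec (dim_col B) (\<lambda>c. (if c = i then of_nat q else 1) * (map_vec of_int z $ c)) =
        (map_vec of_int ?y :: rat vec)"
      using z by (intro eq_vecI) auto
    then show ?thesis using z by (simp add: sparse_basis_mult_vec)
  qed
  then have ge: "euclid_norm (B *\<^sub>v map_vec of_int ?y) \<le> lambda1 (lattice_of ?B')"
    using euclid_norm_extend_vec_ge(1)[of "B *\<^sub>v map_vec of_int ?y" 0] norm by simp
  have "?y \<noteq> 0\<^sub>v (dim_col B)" using z q by (auto simp: vec_eq_iff split: if_splits)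
  then have "map_vec of_int ?y \<noteq> (0\<^sub>v (dim_col B) :: rat vec)"
    by (subst map_vec_of_int_eq_zero_iff) auto
  then have "lambda1 (lattice_of B) \<le> euclid_norm (B *\<^sub>v map_vec of_int ?y)"
    by (intro lambda1_le_norm mult_mat_vec_nonzero[OF B])
      (auto simp: lattice_of_def intro!: exI[of _ ?y])
  with ge show ?thesis by simp
qed

lemma sparse_target_close:
  assumes B: "is_lattice_basis B" and q: "even q" "0 < q" and s: "0 < s"
    and short: "lambda1 (lattice_of B) \<le> of_rat d"
  shows "\<exists>i < dim_col B. \<exists>j < q. odd j \<and>
    lattice_dist (sparse_target B i j s) (lattice_of (sparse_basis B i q)) \<le> of_rat (d + s)"
proof -
  obtain z where z: "z \<in> carrier_vec (dim_col B)" "z \<noteq> 0\<^sub>v (dim_col B)"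
    and norm: "euclid_norm (B *\<^sub>v map_vec of_int z) = lambda1 (lattice_of B)"
    using lambda1_attained[OF B] .
  obtain i where i: "i < dim_col B" "odd (z $ i)"
    using shortest_vector_odd_coefficient[OF B z norm] by blast
  define j where "j = nat (z $ i mod int q)"
  have j: "int j = z $ i mod int q" using q by (simp add: j_def)
  have "j < q" using j q by (metis of_nat_0_less_iff of_nat_less_iff pos_mod_bound)
  \<comment> \<open>Reduction modulo an even \<open>q\<close> preserves parity.\<close>
  have "odd (int j)" unfolding j using i q by (simp add: dvd_mod_iff)
  then have "odd j" by simp
  \<comment> \<open>The signs are such that for \<open>k = 1\<close> the difference has the
    coefficients of \<open>z\<close>: at \<open>i\<close> because
    \<open>j + q * (z $ i div q) = z $ i\<close>, elsewhere by double negation.\<close>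
  define y where "y = vec (dim_col B) (\<lambda>c. if c = i then - (z $ c div int q) else - z $ c)"
  have y: "y \<in> carrier_vec (dim_col B)" by (simp add: y_def)
  have "vec (dim_col B) (\<lambda>c. if c = i then 1 * int j - int q * y $ c else - y $ c) = z"
    using z i by (intro eq_vecI) (auto simp: y_def j)
  with sparse_difference[OF y i(1), of 1 j s q]
  have diff: "sparse_target B i j s - sparse_basis B i q *\<^sub>v map_vec of_int y =
      extend_vec (B *\<^sub>v map_vec of_int z) s"
    by simp
  have "lattice_dist (sparse_target B i j s) (lattice_of (sparse_basis B i q)) \<le>
      euclid_norm (sparse_target B i j s - sparse_basis B i q *\<^sub>v map_vec of_int y)"
    by (rule lattice_dist_le_norm) (use y in \<open>auto simp: lattice_of_def sparse_basis_def\<close>)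
  also have "\<dots> \<le> lambda1 (lattice_of B) + of_rat s"
    unfolding diff using euclid_norm_extend_vec_le[of "B *\<^sub>v map_vec of_int z" s] norm s by simp
  also have "\<dots> \<le> of_rat (d + s)" using short by (simp add: of_rat_add)
  finally show ?thesis using i \<open>j < q\<close> \<open>odd j\<close> by blast
qed

text \<open>For \<open>k\<close> not divisible by \<open>q\<close>, the \<open>i\<close>-th coefficient of \<open>k t - v\<close> is nonzero modulo \<open>q\<close>, as
  \<open>j\<close> is a unit modulo \<open>q\<close>.\<close>

lemma sparse_target_far:
  assumes B: "is_lattice_basis B" and i: "i < dim_col B" and q: "0 < q" and j: "coprime j q"
    and s: "0 < s" and k: "k \<noteq> 0"
    and long: "b \<le> lambda1 (lattice_of B)" "b \<le> of_nat q * of_rat s"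
  shows "b \<le> lattice_dist (of_int k \<cdot>\<^sub>v sparse_target B i j s) (lattice_of (sparse_basis B i q))"
  unfolding lattice_dist_def
proof (rule cInf_greatest)
  show "{euclid_norm (of_int k \<cdot>\<^sub>v sparse_target B i j s - v) |v.
      v \<in> lattice_of (sparse_basis B i q)} \<noteq> {}"
    unfolding lattice_of_def using zero_carrier_vec by blast
next
  fix l assume "l \<in> {euclid_norm (of_int k \<cdot>\<^sub>v sparse_target B i j s - v) |v.
      v \<in> lattice_of (sparse_basis B i q)}"
  then obtain z where z: "z \<in> carrier_vec (dim_col B)"
    and l: "l = euclid_norm (of_int k \<cdot>\<^sub>v sparse_target B i j s -
      sparse_basis B i q *\<^sub>v map_vec of_int z)"
    by (auto simp: lattice_of_def sparse_basis_def)
  let ?y = "vec (dim_col B) (\<lambda>c. if c = i then k * int j - int q * z $ c else - z $ c)"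
  have l: "l = euclid_norm (extend_vec (B *\<^sub>v map_vec of_int ?y) (of_int k * s))"
    unfolding l sparse_difference[OF z i] ..
  show "b \<le> l"
  proof (cases "int q dvd k")
    case True
    then have "int q \<le> \<bar>k\<bar>" using k by (metis dvd_abs_iff zdvd_imp_le zero_less_abs_iff)
    then have "real q \<le> \<bar>of_int k\<bar>" by linarith
    then have "of_nat q * of_rat s \<le> \<bar>of_rat (of_int k * s) :: real\<bar>"
      using s by (simp add: of_rat_mult abs_mult)
    also have "\<dots> \<le> l" unfolding l by (rule euclid_norm_extend_vec_ge)
    finally show ?thesis using long by simp
  next
    case False
    have "\<not> int q dvd k * int j"
      using False j by (simp add: coprime_dvd_mult_left_iff coprime_commute)
    then have "?y $ i \<noteq> 0" using i by auto
    then have "?y \<noteq> 0\<^sub>v (dim_col B)" using i by (metis index_zero_vec(1))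
    then have "map_vec of_int ?y \<noteq> (0\<^sub>v (dim_col B) :: rat vec)"
      by (subst map_vec_of_int_eq_zero_iff) auto
    then have "lambda1 (lattice_of B) \<le> euclid_norm (B *\<^sub>v map_vec of_int ?y)"
      by (intro lambda1_le_norm mult_mat_vec_nonzero[OF B])
        (auto simp: lattice_of_def intro!: exI[of _ ?y])
    also have "\<dots> \<le> l" unfolding l by (rule euclid_norm_extend_vec_ge)
    finally show ?thesis using long by simp
  qed
qed

section \<open>Encodings\<close>

text \<open>Only numerators are multiplied: denominators stay positive, and as fractions need not be
  reduced, no gcd is ever computed.\<close>

definition scaled_rats :: "word \<Rightarrow> nat \<Rightarrow> int \<Rightarrow> nat \<Rightarrow> word" where
  "scaled_rats w p f k = concat (map (\<lambda>r. [f * w ! (p + 2 * r), w ! (p + 2 * r + 1)]) [0..<k])"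

text \<open>The part of well-formedness that the program tests. The length counts two dimensions,
  the fraction \<open>d\<close> and one fraction per entry. Positive denominators and linear
  independence are left to the promise.\<close>

definition svp_word :: "word \<Rightarrow> nat \<Rightarrow> nat \<Rightarrow> bool" where
  "svp_word w m n \<longleftrightarrow> 0 < m \<and> 0 < n \<and> length w = 4 + 2 * m * n \<and> w ! 0 = int m \<and> w ! 1 = int n"

text \<open>Cut off after \<open>k\<close> columns to serve as a loop invariant. The letters
  \<open>[0, 1]\<close> are the fraction \<open>0/1\<close> in the additional row.\<close>

definition cvp_columns :: "word \<Rightarrow> nat \<Rightarrow> nat \<Rightarrow> nat \<Rightarrow> nat \<Rightarrow> word" where
  "cvp_columns w m q i k =
     concat (map (\<lambda>c. scaled_rats w (4 + 2 * m * c) (if c = i then int q else 1) m @ [0, 1]) [0..<k])"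

text \<open>As \<open>d\<close> is \<open>w ! 2\<close> over \<open>w ! 3\<close>, the first
  fraction is \<open>d (1 + 1/n)\<close> and the one after the scaled column is \<open>d/n\<close>,
  both over the denominator \<open>w ! 3 * n\<close>.\<close>

definition cvp_word :: "word \<Rightarrow> nat \<Rightarrow> nat \<Rightarrow> nat \<Rightarrow> nat \<Rightarrow> nat \<Rightarrow> word" where
  "cvp_word w m n q i j =
     [int m + 1, int n, w ! 2 * (int n + 1), w ! 3 * int n] @
     scaled_rats w (4 + 2 * m * i) (int j) m @ [w ! 2, w ! 3 * int n] @ cvp_columns w m q i n"

lemma svp_word_bounds:
  assumes "svp_word w m n"
  shows "0 < m" "0 < n" "length w = 4 + 2 * m * n" "2 * m + 4 \<le> length w" "2 * n + 4 \<le> length w"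
  using assms by (simp_all add: svp_word_def)

lemma length_scaled_rats [simp]: "length (scaled_rats w p f k) = 2 * k"
  by (induction k) (simp_all add: scaled_rats_def)

lemma scaled_rats_Suc:
  "scaled_rats w p f (Suc k) = scaled_rats w p f k @ [f * w ! (p + 2 * k), w ! (p + 2 * k + 1)]"
  by (simp add: scaled_rats_def)

lemma length_cvp_columns [simp]: "length (cvp_columns w m q i k) = 2 * (m + 1) * k"
  by (induction k) (simp_all add: cvp_columns_def algebra_simps)

lemma cvp_columns_Suc:
  "cvp_columns w m q i (Suc k) = cvp_columns w m q i k @
     scaled_rats w (4 + 2 * m * k) (if k = i then int q else 1) m @ [0, 1]"
  by (simp add: cvp_columns_def)

lemma length_cvp_word [simp]: "length (cvp_word w m n q i j) = 4 + 2 * (m + 1) * (n + 1)"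
  by (simp add: cvp_word_def algebra_simps)

section \<open>Composing and indexing encodings of rationals\<close>

lemma encodes_rats_Nil: "encodes_rats [] []"
  by (auto simp: encodes_rats_def)

lemma encodes_rats_pair: "0 < b \<Longrightarrow> x = of_int a / of_int b \<Longrightarrow> encodes_rats [a, b] [x]"
  unfolding encodes_rats_def by (intro exI[of _ "[(a, b)]"]) simp

lemma encodes_rats_append:
  assumes "encodes_rats u xs" "encodes_rats v ys"
  shows "encodes_rats (u @ v) (xs @ ys)"
proof -
  obtain ps where "\<forall>(a, b) \<in> set ps. 0 < b" "xs = map (\<lambda>(a, b). of_int a / of_int b) ps"
      "u = concat (map (\<lambda>(a, b). [a, b]) ps)"
    using assms(1) by (auto simp: encodes_rats_def)
  moreover obtain ps' where "\<forall>(a, b) \<in> set ps'. 0 < b" "ys = map (\<lambda>(a, b). of_int a / of_int b) ps'"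
      "v = concat (map (\<lambda>(a, b). [a, b]) ps')"
    using assms(2) by (auto simp: encodes_rats_def)
  ultimately show ?thesis
    unfolding encodes_rats_def by (intro exI[of _ "ps @ ps'"]) auto
qed

lemma encodes_rats_concat:
  assumes "\<And>c. c < k \<Longrightarrow> encodes_rats (f c) (g c)"
  shows "encodes_rats (concat (map f [0..<k])) (concat (map g [0..<k]))"
  using assms by (induction k) (simp_all add: encodes_rats_Nil encodes_rats_append)

lemma concat_pairs_nth:
  assumes "k < length ps"
  shows "concat (map (\<lambda>(a, b). [a, b]) ps) ! (2 * k) = fst (ps ! k)"
    "concat (map (\<lambda>(a, b). [a, b]) ps) ! (2 * k + 1) = snd (ps ! k)"
  using assms
proof (induction ps arbitrary: k)
  case (Cons p ps)
  { case 1 then show ?case using Cons.IH(1)[of "k - 1"] by (cases k; cases p) auto }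
  { case 2 then show ?case using Cons.IH(2)[of "k - 1"] by (cases k; cases p) auto }
qed simp_all

lemma length_concat_pairs: "length (concat (map (\<lambda>(a, b). [a, b]) ps)) = 2 * length ps"
  by (induction ps) auto

lemma encodes_rats_nth:
  assumes "encodes_rats u xs" "k < length xs"
  shows "0 < u ! (2 * k + 1)" "xs ! k = of_int (u ! (2 * k)) / of_int (u ! (2 * k + 1))"
proof -
  obtain ps where ps: "\<forall>(a, b) \<in> set ps. 0 < b" "xs = map (\<lambda>(a, b). of_int a / of_int b) ps"
      "u = concat (map (\<lambda>(a, b). [a, b]) ps)"
    using assms(1) by (auto simp: encodes_rats_def)
  with assms(2) have k: "k < length ps" by simp
  then have "ps ! k \<in> set ps" by simp
  with ps(1) show "0 < u ! (2 * k + 1)"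
    unfolding ps(3) concat_pairs_nth[OF k] by auto
  show "xs ! k = of_int (u ! (2 * k)) / of_int (u ! (2 * k + 1))"
    using k unfolding ps(2,3) concat_pairs_nth[OF k] by (simp split: prod.splits)
qed

lemma encodes_rats_length: "encodes_rats u xs \<Longrightarrow> length u = 2 * length xs"
  by (auto simp: encodes_rats_def length_concat_pairs)

lemma concat_map_upt_nth:
  assumes "\<And>c. length (f c) = m" "c < n" "r < m"
  shows "concat (map f [0..<n]) ! (m * c + r) = f c ! r"
  using assms(2)
proof (induction n)
  case (Suc n)
  have len: "length (concat (map f [0..<n])) = m * n" for n
    by (induction n) (simp_all add: assms(1))
  show ?case
  proof (cases "c = n")
    case True
    then show ?thesis using len[of n] by (simp add: nth_append)
  next
    case False
    with Suc have "c < n" by simp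
    then have "m * c + m \<le> m * n" by (metis Suc_leI mult_Suc_right mult_le_mono2 add.commute)
    with Suc \<open>c < n\<close> assms(3) len[of n] show ?thesis by (simp add: nth_append)
  qed
qed simp

section \<open>From the word of the given lattice to the words of the queries\<close>

lemma basis_entries_eq:
  "basis_entries B = concat (map (\<lambda>c. map (\<lambda>r. B $$ (r, c)) [0..<dim_row B]) [0..<dim_col B])"
  by (auto simp: basis_entries_def cols_def list_of_vec_map intro!: arg_cong[of _ _ concat])

lemma encodes_svp_entries:
  assumes "encodes_svp w B d" "is_lattice_basis B"
  defines "m \<equiv> dim_row B" and "n \<equiv> dim_col B"
  shows "svp_word w m n" "0 < w ! 3" "d = of_int (w ! 2) / of_int (w ! 3)"
    "c < n \<Longrightarrow> r < m \<Longrightarrow> 0 < w ! (4 + 2 * m * c + 2 * r + 1)"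
    "c < n \<Longrightarrow> r < m \<Longrightarrow> B $$ (r, c) =
       of_int (w ! (4 + 2 * m * c + 2 * r)) / of_int (w ! (4 + 2 * m * c + 2 * r + 1))"
proof -
  obtain u where w: "w = int m # int n # u" and u: "encodes_rats u (d # basis_entries B)"
    using assms(1) by (auto simp: encodes_svp_def m_def n_def)
  have len: "length (basis_entries B) = m * n"
    by (simp add: basis_entries_eq length_concat comp_def sum_list_triv m_def n_def)
  have "0 < n" using assms(2) by (simp add: is_lattice_basis_def n_def)
  \<comment> \<open>Without rows even the first unit vector lies in the kernel, against linear
    independence.\<close>
  moreover have "0 < m"
  proof (rule ccontr)
    assume "\<not> 0 < m"
    then have "B *\<^sub>v unit_vec n 0 = 0\<^sub>v (dim_row B)" by (auto simp: m_def)
    then have "unit_vec n 0 = (0\<^sub>v n :: rat vec)"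
      using assms(2) by (auto simp: is_lattice_basis_def n_def)
    with \<open>0 < n\<close> show False by (auto simp: vec_eq_iff)
  qed
  moreover have "length w = 4 + 2 * m * n"
    using encodes_rats_length[OF u] len by (simp add: w)
  ultimately show "svp_word w m n" by (simp add: svp_word_def w)
  show "0 < w ! 3" "d = of_int (w ! 2) / of_int (w ! 3)"
    using encodes_rats_nth[OF u, of 0] by (simp_all add: w numeral_3_eq_3 numeral_2_eq_2)
  assume cr: "c < n" "r < m"
  then have "m * c + m \<le> m * n" by (metis Suc_leI mult_Suc_right mult_le_mono2 add.commute)
  \<comment> \<open>\<open>Suc\<close> skips \<open>d\<close>, which precedes the entries. Together
    with the two dimensions in front of \<open>u\<close> this yields the offset 4 in
    \<open>w\<close>.\<close>
  with cr have lt: "Suc (m * c + r) < length (d # basis_entries B)" by (simp add: len)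
  have entry: "(d # basis_entries B) ! Suc (m * c + r) = B $$ (r, c)"
    using cr concat_map_upt_nth[of "\<lambda>c. map (\<lambda>r. B $$ (r, c)) [0..<m]" m c n r]
    by (simp add: basis_entries_eq m_def n_def)
  have idx: "w ! (4 + 2 * m * c + 2 * r) = u ! (2 * Suc (m * c + r))"
    "w ! (4 + 2 * m * c + 2 * r + 1) = u ! (2 * Suc (m * c + r) + 1)"
    by (simp_all add: w algebra_simps nth_Cons' numeral_3_eq_3)
  show "0 < w ! (4 + 2 * m * c + 2 * r + 1)"
    using encodes_rats_nth(1)[OF u lt] unfolding idx .
  show "B $$ (r, c) =
      of_int (w ! (4 + 2 * m * c + 2 * r)) / of_int (w ! (4 + 2 * m * c + 2 * r + 1))"
    using encodes_rats_nth(2)[OF u lt] unfolding idx entry .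
qed

lemma encodes_cvp_word:
  assumes w: "encodes_svp w B d" and B: "is_lattice_basis B" and i: "i < dim_col B"
  defines "n \<equiv> dim_col B"
  shows "encodes_cvp (cvp_word w (dim_row B) n q i j) (sparse_basis B i q)
    (sparse_target B i j (d / of_nat n)) (d * (1 + 1 / of_nat n))"
proof -
  define m where "m = dim_row B"
  note entries = encodes_svp_entries[OF w B, folded m_def n_def]
  have "0 < n" using entries(1) by (simp add: svp_word_def)
  have column: "encodes_rats (scaled_rats w (4 + 2 * m * c) f m)
      (map (\<lambda>r. of_int f * B $$ (r, c)) [0..<m])" if "c < n" for c f
  proof -
    have "encodes_rats (scaled_rats w (4 + 2 * m * c) f m)
        (concat (map (\<lambda>r. [of_int f * B $$ (r, c)]) [0..<m]))"
      unfolding scaled_rats_def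
      by (intro encodes_rats_concat encodes_rats_pair) (use entries(4,5)[OF that] in auto)
    then show ?thesis by (simp add: map_concat[symmetric] comp_def concat_map_singleton)
  qed
  have s: "encodes_rats [w ! 2, w ! 3 * int n] [d / of_nat n]"
    using entries(2,3) \<open>0 < n\<close> by (intro encodes_rats_pair) auto
  have d: "encodes_rats [w ! 2 * (int n + 1), w ! 3 * int n] [d * (1 + 1 / of_nat n)]"
    using entries(2,3) \<open>0 < n\<close> by (intro encodes_rats_pair) (auto simp: field_simps)
  have t: "list_of_vec (sparse_target B i j (d / of_nat n)) =
      map (\<lambda>r. of_int (int j) * B $$ (r, i)) [0..<m] @ [d / of_nat n]"
    using i by (auto simp: sparse_target_def extend_vec_def list_of_vec_map m_def)
  have basis: "basis_entries (sparse_basis B i q) = concat (map (\<lambda>c.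
      map (\<lambda>r. of_int (if c = i then int q else 1) * B $$ (r, c)) [0..<m] @ [0]) [0..<n])"
    by (auto simp: basis_entries_eq sparse_basis_def m_def n_def intro!: arg_cong[of _ _ concat])
  have columns: "encodes_rats (cvp_columns w m q i n) (basis_entries (sparse_basis B i q))"
    unfolding basis cvp_columns_def
    by (intro encodes_rats_concat encodes_rats_append column encodes_rats_pair) auto
  let ?u = "[w ! 2 * (int n + 1), w ! 3 * int n] @
     (scaled_rats w (4 + 2 * m * i) (int j) m @ [w ! 2, w ! 3 * int n]) @ cvp_columns w m q i n"
  have "encodes_rats ?u ([d * (1 + 1 / of_nat n)] @
      (map (\<lambda>r. of_int (int j) * B $$ (r, i)) [0..<m] @ [d / of_nat n]) @
      basis_entries (sparse_basis B i q))"
    by (intro encodes_rats_append d s columns column) (use i in \<open>simp add: n_def\<close>)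
  then have "encodes_rats ?u (d * (1 + 1 / of_nat n) #
      list_of_vec (sparse_target B i j (d / of_nat n)) @ basis_entries (sparse_basis B i q))"
    unfolding t by simp
  then show ?thesis
    unfolding encodes_cvp_def cvp_word_def by (simp add: sparse_basis_def m_def n_def)
qed

section \<open>Running programs on integers of bounded size\<close>

text \<open>The count \<open>k\<close> is measured in units that pay for one instruction on operands of absolute
  value at most \<open>b\<close>.\<close>

definition runs :: "oracle_fun \<Rightarrow> int \<Rightarrow> com \<Rightarrow> (reg \<Rightarrow> int) \<Rightarrow> (int \<Rightarrow> int) \<Rightarrow>
    (nat \<Rightarrow> (reg \<Rightarrow> int) \<Rightarrow> (int \<Rightarrow> int) \<Rightarrow> bool) \<Rightarrow> bool" where
  "runs Q b c R M P \<longleftrightarrow> (\<exists>T k R' M'.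
     exec Q c (R, M) T (R', M') \<and> T \<le> k * (1 + 2 * int_size b) \<and> P k R' M')"

abbreviation Seq_infix :: "com \<Rightarrow> com \<Rightarrow> com" (infixr \<open>;;\<close> 60) where
  "c1 ;; c2 \<equiv> Seq c1 c2"

lemma int_size_mono: "\<bar>x\<bar> \<le> b \<Longrightarrow> int_size x \<le> int_size b"
  by (simp add: int_size_def floorlog_mono nat_mono)

lemma runs_weaken:
  "runs Q b c R M P \<Longrightarrow> (\<And>k R' M'. P k R' M' \<Longrightarrow> P' k R' M') \<Longrightarrow> runs Q b c R M P'"
  unfolding runs_def by blast

lemma runs_Skip: "P 1 R M \<Longrightarrow> runs Q b Skip R M P"
  unfolding runs_def by (rule exI, rule exI[of _ 1], intro exI conjI, rule exec.Skip) auto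

lemma runs_Const: "\<bar>z\<bar> \<le> b \<Longrightarrow> P 1 (R(r := z)) M \<Longrightarrow> runs Q b (Const r z) R M P"
  unfolding runs_def
  by (rule exI, rule exI[of _ 1], intro exI conjI, rule exec.Const) (use int_size_mono[of z b] in auto)

lemma runs_Arith:
  "\<bar>R x\<bar> \<le> b \<Longrightarrow> \<bar>R y\<bar> \<le> b \<Longrightarrow> P 1 (R(r := apply_op f (R x) (R y))) M \<Longrightarrow>
   runs Q b (Arith f r x y) R M P"
  unfolding runs_def
  by (rule exI, rule exI[of _ 1], intro exI conjI, rule exec.Arith)
    (use int_size_mono[of "R x" b] int_size_mono[of "R y" b] in auto)

lemma runs_Load:
  "\<bar>R a\<bar> \<le> b \<Longrightarrow> \<bar>M (R a)\<bar> \<le> b \<Longrightarrow> P 1 (R(r := M (R a))) M \<Longrightarrow> runs Q b (Load r a) R M P"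
  unfolding runs_def
  by (rule exI, rule exI[of _ 1], intro exI conjI, rule exec.Load)
    (use int_size_mono[of "R a" b] int_size_mono[of "M (R a)" b] in auto)

lemma runs_Store:
  "\<bar>R a\<bar> \<le> b \<Longrightarrow> \<bar>R r\<bar> \<le> b \<Longrightarrow> P 1 R (M(R a := R r)) \<Longrightarrow> runs Q b (Store a r) R M P"
  unfolding runs_def
  by (rule exI, rule exI[of _ 1], intro exI conjI, rule exec.Store)
    (use int_size_mono[of "R a" b] int_size_mono[of "R r" b] in auto)

text \<open>The price of a query is the size of the whole word, so it is paid with one unit per
  letter and one more for the operands.\<close>

lemma runs_Query:
  assumes "read_word M (R a) (R l) = w" "\<bar>R a\<bar> \<le> b" "\<bar>R l\<bar> \<le> b" "\<And>z. z \<in> set w \<Longrightarrow> \<bar>z\<bar> \<le> b"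
    and "P (Suc (length w)) (R(r := if Q w then 1 else 0)) M"
  shows "runs Q b (Query r a l) R M P"
proof -
  have "word_size w \<le> (\<Sum>z\<leftarrow>w. int_size b)"
    unfolding word_size_def by (intro sum_list_mono int_size_mono assms(4))
  also have "\<dots> = length w * int_size b" by (simp add: sum_list_triv)
  also have "\<dots> \<le> length w * (1 + 2 * int_size b)" by simp
  finally have "1 + int_size (R a) + int_size (R l) + word_size w
      \<le> Suc (length w) * (1 + 2 * int_size b)"
    using int_size_mono[OF assms(2)] int_size_mono[OF assms(3)] by simp
  then show ?thesis
    unfolding runs_def using exec.Query[OF assms(1)[symmetric]] assms(5) by blast
qed

text \<open>The postcondition of \<open>c1\<close> is again a \<open>runs\<close> statement, so
  straight-line code is executed symbolically by introduction rules while the counts add up.\<close>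

lemma runs_Seq:
  assumes "runs Q b c1 R M (\<lambda>k R' M'. runs Q b c2 R' M' (\<lambda>k'. P (k + k')))"
  shows "runs Q b (c1 ;; c2) R M P"
proof -
  obtain T1 k1 R1 M1 T2 k2 R2 M2 where
    "exec Q c1 (R, M) T1 (R1, M1)" "T1 \<le> k1 * (1 + 2 * int_size b)"
    "exec Q c2 (R1, M1) T2 (R2, M2)" "T2 \<le> k2 * (1 + 2 * int_size b)" "P (k1 + k2) R2 M2"
    using assms unfolding runs_def by blast
  then have "exec Q (c1 ;; c2) (R, M) (T1 + T2) (R2, M2)"
    "T1 + T2 \<le> (k1 + k2) * (1 + 2 * int_size b)" "P (k1 + k2) R2 M2"
    using exec.Seq by (blast, simp add: algebra_simps, blast)
  then show ?thesis unfolding runs_def by blast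
qed

lemma runs_SeqI:
  assumes "runs Q b c1 R M P1"
    and "\<And>k R' M'. P1 k R' M' \<Longrightarrow> runs Q b c2 R' M' (\<lambda>k'. P (k + k'))"
  shows "runs Q b (c1 ;; c2) R M P"
  by (rule runs_Seq, rule runs_weaken[OF assms])

lemma runs_IfPos:
  assumes "\<bar>R r\<bar> \<le> b"
    and "R r > 0 \<Longrightarrow> runs Q b c1 R M (\<lambda>k. P (Suc k))"
    and "\<not> R r > 0 \<Longrightarrow> runs Q b c2 R M (\<lambda>k. P (Suc k))"
  shows "runs Q b (IfPos r c1 c2) R M P"
proof -
  let ?c = "if R r > 0 then c1 else c2"
  have "runs Q b ?c R M (\<lambda>k. P (Suc k))" using assms by simp
  then obtain T k R' M' where
    ex: "exec Q ?c (R, M) T (R', M')" "T \<le> k * (1 + 2 * int_size b)" "P (Suc k) R' M'"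
    unfolding runs_def by blast
  have "exec Q (IfPos r c1 c2) (R, M) (1 + int_size (R r) + T) (R', M')"
    using ex(1) exec.IfTrue exec.IfFalse by (cases "R r > 0") auto
  moreover have "1 + int_size (R r) + T \<le> Suc k * (1 + 2 * int_size b)"
    using ex(2) int_size_mono[OF assms(1)] by simp
  ultimately show ?thesis unfolding runs_def using ex(3) by blast
qed

text \<open>The index of the invariant bounds the remaining passes. A pass is charged
  \<open>K\<close> units and one for its test; the final \<open>+ 1\<close> is the failing test. The
  index at exit is left open and has to be recovered from the invariant and the tested
  register.\<close>

lemma runs_WhilePos:
  assumes start: "I N R M"
    and bound: "\<And>i R M. I i R M \<Longrightarrow> \<bar>R r\<bar> \<le> b"
    and body: "\<And>i R M. I i R M \<Longrightarrow> R r > 0 \<Longrightarrow>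
      0 < i \<and> runs Q b c R M (\<lambda>k R' M'. k \<le> K \<and> I (i - 1) R' M')"
  shows "runs Q b (WhilePos r c) R M
    (\<lambda>k R' M'. k \<le> N * (K + 1) + 1 \<and> (\<exists>i. I i R' M' \<and> \<not> R' r > 0))"
  using start
proof (induction N arbitrary: R M rule: less_induct)
  case (less N)
  show ?case
  proof (cases "R r > 0")
    case False
    have "1 + int_size (R r) \<le> 1 * (1 + 2 * int_size b)"
      using int_size_mono[OF bound[OF less.prems]] by simp
    then show ?thesis
      unfolding runs_def using exec.WhileFalse[of R r Q c M] False less.prems
      by (intro exI[of _ "1 + int_size (R r)"] exI[of _ 1]) auto
  next
    case True
    from body[OF less.prems True] obtain T1 k1 R1 M1 where N: "0 < N"
      and 1: "exec Q c (R, M) T1 (R1, M1)" "T1 \<le> k1 * (1 + 2 * int_size b)" "k1 \<le> K"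
      and I: "I (N - 1) R1 M1"
      unfolding runs_def by blast
    have "N - 1 < N" using N by simp
    from less.IH[OF _ I] obtain T2 k2 R2 M2 where
      2: "exec Q (WhilePos r c) (R1, M1) T2 (R2, M2)" "T2 \<le> k2 * (1 + 2 * int_size b)"
        "k2 \<le> (N - 1) * (K + 1) + 1" and post: "\<exists>i. I i R2 M2 \<and> \<not> R2 r > 0"
      unfolding runs_def using \<open>N - 1 < N\<close> by blast
    have "exec Q (WhilePos r c) (R, M) (1 + int_size (R r) + T1 + T2) (R2, M2)"
      by (rule exec.WhileTrue[OF True 1(1) 2(1)])
    moreover have "1 + int_size (R r) + T1 + T2 \<le> (1 + k1 + k2) * (1 + 2 * int_size b)"
      using 1(2) 2(2) int_size_mono[OF bound[OF less.prems]] by (simp add: algebra_simps)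
    moreover have "1 + k1 + k2 \<le> N * (K + 1) + 1"
    proof -
      have "1 + k1 + k2 \<le> (K + 1) + ((N - 1) * (K + 1) + 1)" using 1(3) 2(3) by simp
      also have "\<dots> = N * (K + 1) + 1" using N by (cases N) auto
      finally show ?thesis .
    qed
    ultimately show ?thesis unfolding runs_def using post by blast
  qed
qed

lemmas runs_intros =
  runs_Skip runs_Const runs_Arith runs_Load runs_Store runs_Seq runs_IfPos

text \<open>Only a prefix of the memory is described; behind it may lie remainders of earlier
  queries.\<close>

definition holds :: "(int \<Rightarrow> int) \<Rightarrow> word \<Rightarrow> bool" where
  "holds M u \<longleftrightarrow> (\<forall>a < length u. M (int a) = u ! a)"

lemma holds_nth: "holds M u \<Longrightarrow> a < length u \<Longrightarrow> M (int a) = u ! a"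
  by (simp add: holds_def)

text \<open>Forgetting the output after a query leaves just the input, so the next query can be
  written over the previous one.\<close>

lemma holds_appendD: "holds M (u @ v) \<Longrightarrow> holds M u"
  by (auto simp: holds_def nth_append)

text \<open>A query starts right behind the input, which is why register 0, the input length, can
  serve as its address.\<close>

lemma holds_read_word:
  "holds M (u @ v) \<Longrightarrow> read_word M (int (length u)) (int (length v)) = v"
  unfolding read_word_def
  by (rule nth_equalityI) (auto simp: holds_def nth_append simp flip: of_nat_add)

lemma holds_append2:
  "holds M u \<Longrightarrow> holds (M(int (length u) := x, int (length u) + 1 := y)) (u @ [x, y])"
  by (auto simp: holds_def nth_append less_Suc_eq)


section \<open>The reduction as a program\<close>

text \<open>Register 0 holds the length of the input \<open>w\<close>, and registers 2 to 9 hold \<open>m\<close>, \<open>n\<close>, \<open>w ! 2\<close>, \<open>w ! 3 * n\<close>,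
  \<open>w ! 2 * (n + 1)\<close>, \<open>q\<close>, \<open>m + 1\<close> and \<open>0\<close>; register 23 holds 1. Register 10 is the end of the output, which is
  written behind the input; 11 is a reading position; 16 is \<open>n - i\<close>, 17 is the position of the
  \<open>i\<close>-th column in the input, 18 is \<open>j\<close>, and 19 records whether a query was answered positively.\<close>

definition emit :: "reg \<Rightarrow> reg \<Rightarrow> com" where
  "emit x y = Store 10 x ;; Arith Add 10 10 23 ;; Store 10 y ;; Arith Add 10 10 23"

text \<open>Register 12 is the factor, register 14 the number of entries still to be copied. Adding
  register 9, which is zero, copies a register, here and below.\<close>

definition copy_column :: com where
  "copy_column = Arith Add 14 2 9 ;;
     WhilePos 14 (Load 13 11 ;; Arith Mul 13 13 12 ;; Arith Add 11 11 23 ;;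
       Load 22 11 ;; Arith Add 11 11 23 ;; emit 13 22 ;; Arith Sub 14 14 23)"

text \<open>Register 15 counts the columns still to be written, so the current column is the
  \<open>i\<close>-th one iff registers 15 and 16 agree. Equality is decided by two sign
  tests.\<close>

definition select_factor :: com where
  "select_factor = Arith Sub 13 15 16 ;;
     IfPos 13 (Const 12 1) (Arith Sub 13 16 15 ;; IfPos 13 (Const 12 1) (Arith Add 12 7 9))"

definition copy_basis :: com where
  "copy_basis = WhilePos 15 (select_factor ;; copy_column ;; emit 9 23 ;; Arith Sub 15 15 23)"

definition query_head :: com where
  "query_head = Arith Add 10 0 9 ;; emit 8 3 ;; emit 6 5 ;; Arith Add 11 17 9 ;; Arith Add 12 18 9"

definition build_query :: com where
  "build_query = query_head ;; copy_column ;; emit 4 5 ;;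
     Const 11 4 ;; Arith Add 15 3 9 ;; copy_basis"

definition try_multiples :: com where
  "try_multiples = WhilePos 18 (build_query ;; Arith Sub 20 10 0 ;; Query 13 0 20 ;;
     IfPos 13 (Const 19 1) Skip ;; Arith Sub 18 18 23 ;; Arith Sub 18 18 23)"

definition try_columns :: com where
  "try_columns = WhilePos 16 (Arith Sub 18 7 23 ;; try_multiples ;;
     Arith Add 17 17 2 ;; Arith Add 17 17 2 ;; Arith Sub 16 16 23)"

text \<open>\<open>K\<close> depends on \<open>\<gamma>\<close> but not on the input, so it is a
  constant of the program and the power is an unrolled product.\<close>

primrec power_loop :: "nat \<Rightarrow> com" where
  "power_loop 0 = Const 7 1"
| "power_loop (Suc K) = power_loop K ;; Arith Mul 7 7 21"

text \<open>Register 21 is doubled until it exceeds \<open>n\<close>; register 14 holds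
  \<open>n + 1\<close> minus register 21 and is positive until then.\<close>

definition compute_modulus :: "nat \<Rightarrow> com" where
  "compute_modulus K = Const 21 1 ;; Arith Add 14 3 9 ;;
     WhilePos 14 (Arith Add 21 21 21 ;; Arith Add 14 3 23 ;; Arith Sub 14 14 21) ;; power_loop K"

definition load_params :: com where
  "load_params = Const 13 2 ;; Load 4 13 ;; Const 13 3 ;; Load 5 13 ;; Arith Mul 5 5 3 ;;
     Arith Add 13 3 23 ;; Arith Mul 6 4 13 ;; Arith Add 8 2 23"

definition solve_svp :: "nat \<Rightarrow> com" where
  "solve_svp K = load_params ;; compute_modulus K ;; Const 17 4 ;; Arith Add 16 3 9 ;; try_columns"

text \<open>Registers 14 and 15 receive the difference between expected and actual length and its
  negative, both nonpositive only for the right length. Register 9 is initially zero, hence a valid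
  address of the first letter.\<close>

definition check_input :: com where
  "check_input = Const 23 1 ;; Load 2 9 ;; Load 3 23 ;; Arith Mul 13 2 3 ;; Arith Add 13 13 13 ;;
     Const 14 4 ;; Arith Add 13 13 14 ;; Arith Sub 14 13 0 ;; Arith Sub 15 0 13"

text \<open>The tests protect the running time, which has to be polynomial on every word, not only
  on instances. A malformed word leaves register 19 at zero and is rejected.\<close>

definition reduction :: "nat \<Rightarrow> com" where
  "reduction K = check_input ;;
     IfPos 2 (IfPos 3 (IfPos 14 Skip (IfPos 15 Skip (solve_svp K))) Skip) Skip ;;
     Arith Add 0 19 9"

text \<open>The base is the least power of two above \<open>n\<close>, hence at most
  \<open>2 * n\<close> for positive \<open>n\<close>. For fixed \<open>K\<close> the modulus
  therefore grows like \<open>n ^ K\<close> and is computable without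
  \<open>\<gamma>\<close>.\<close>

definition modulus :: "nat \<Rightarrow> nat \<Rightarrow> nat" where
  "modulus K n = (2 ^ floorlog 2 n) ^ K"

text \<open>The first product pays for writing a query, the rest for reading its
  \<open>4 + 2 * (m + 1) * (n + 1)\<close> letters and for the bookkeeping of one pass.\<close>

definition query_steps :: "nat \<Rightarrow> nat \<Rightarrow> nat" where
  "query_steps m n = (n + 1) * (11 * m + 20) + 2 * (m + 1) * (n + 1) + 10"

text \<open>Two levels of bounds: \<open>Y\<close> for the letters, the length and \<open>q\<close>,
  and \<open>b\<close> for all computed values. The largest of these are products of two numbers
  bounded by \<open>Y\<close>, and addresses, which stay within five times the input length.\<close>

locale reduction_run =
  fixes w :: word and m n q :: nat and Y b :: int and Q :: oracle_fun
  assumes word: "svp_word w m n"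
    and entry_le: "z \<in> set w \<Longrightarrow> \<bar>z\<bar> \<le> Y"
    and length_le: "int (length w) \<le> Y"
    and q_le: "int q \<le> Y"
    and b_ge: "10 * Y \<le> b" "Y * Y \<le> b"
begin

lemmas mn_pos = svp_word_bounds(1,2)[OF word]

lemmas len_w = svp_word_bounds(3)[OF word]

lemmas mn_le = svp_word_bounds(4,5)[OF word]

lemma Y_ge: "4 \<le> Y" "int m + 1 \<le> Y" "int n + 1 \<le> Y"
  using length_le mn_le by linarith+

lemma nth_le: "a < length w \<Longrightarrow> \<bar>w ! a\<bar> \<le> Y"
  using entry_le by simp

lemma mult_le_b: "\<bar>x\<bar> \<le> Y \<Longrightarrow> \<bar>y\<bar> \<le> Y \<Longrightarrow> \<bar>x * y\<bar> \<le> b"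
  using mult_mono[of "\<bar>x\<bar>" Y "\<bar>y\<bar>" Y] Y_ge b_ge by (simp add: abs_mult)

lemma query_length_le: "2 * (m + 1) * (n + 1) + 4 \<le> 4 * length w"
proof -
  have "2 * (m + 1) * (n + 1) \<le> 2 * (2 * m) * (2 * n)"
    using mn_pos by (intro mult_mono) auto
  then show ?thesis by (simp add: len_w)
qed

lemma address_le: "int (length w + 4 + 2 * (m + 1) * (n + 1)) \<le> b"
  using query_length_le length_le b_ge Y_ge by linarith

section \<open>Writing one query behind the input\<close>

lemma runs_emit:
  assumes "holds M u" "R 10 = int (length u)" "R 23 = 1" "\<bar>R x\<bar> \<le> b" "\<bar>R y\<bar> \<le> b"
    and "x \<noteq> 10" "y \<noteq> 10" "int (length u) + 1 \<le> b"
    and "\<And>M'. holds M' (u @ [R x, R y]) \<Longrightarrow> P 4 (R(10 := int (length u) + 2)) M'"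
  shows "runs Q b (emit x y) R M P"
proof -
  have "(1 :: nat) + (1 + (1 + 1)) = 4" "int (length u) + 1 + 1 = int (length u) + 2" by simp_all
  then have "P (1 + (1 + (1 + 1))) (R(10 := int (length u) + 1 + 1))
      (M(int (length u) := R x, int (length u) + 1 := R y))"
    using assms(9)[OF holds_append2[OF assms(1)]] by metis
  then show ?thesis
    unfolding emit_def using assms(2-8) by (intro runs_intros) auto
qed

text \<open>\<open>v\<close> is the output written so far. A pass takes 10 units and its test one;
  the remaining 2 set the counter and perform the failing test.\<close>

lemma runs_copy_column:
  assumes R: "R 23 = 1" "R 9 = 0" "R 2 = int m" "R 10 = int (length w + length v)"
      "R 11 = int p" "R 12 = f"
    and M: "holds M (w @ v)"
    and p: "p + 2 * m \<le> length w" and f: "\<bar>f\<bar> \<le> Y"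
    and out: "int (length w + length v + 2 * m) \<le> b"
  shows "runs Q b copy_column R M (\<lambda>k R' M'. k \<le> 11 * m + 2 \<and>
    holds M' (w @ v @ scaled_rats w p f m) \<and> R' 10 = int (length w + length v + 2 * m) \<and>
    R' 11 = int (p + 2 * m) \<and> (\<forall>r. r \<notin> {10, 11, 13, 14, 22} \<longrightarrow> R' r = R r))"
proof -
  define I where "I i R' M' \<longleftrightarrow> i \<le> m \<and> R' 14 = int i \<and>
    holds M' (w @ v @ scaled_rats w p f (m - i)) \<and>
    R' 10 = int (length w + length v + 2 * (m - i)) \<and>
    R' 11 = int (p + 2 * (m - i)) \<and> (\<forall>r. r \<notin> {10, 11, 13, 14, 22} \<longrightarrow> R' r = R r)"
    for i and R' :: "reg \<Rightarrow> int" and M'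
  have body: "runs Q b (Load 13 11 ;; Arith Mul 13 13 12 ;; Arith Add 11 11 23 ;;
      Load 22 11 ;; Arith Add 11 11 23 ;; emit 13 22 ;; Arith Sub 14 14 23) R' M'
      (\<lambda>k R' M'. k \<le> 10 \<and> I (i - 1) R' M')"
    if I: "I i R' M'" "0 < i" for i R' M'
  proof -
    define k where "k = m - i"
    have k: "m - (i - 1) = Suc k" "k < m" "i = m - k" using I by (auto simp: I_def k_def)
    note regs = I(1)[unfolded I_def, folded k_def]
    have M': "holds M' (w @ v @ scaled_rats w p f k)" using regs by simp
    have "p + 2 * k + 1 < length w" using p k by simp
    then have ld: "M' (int p + 2 * int k) = w ! (p + 2 * k)"
      "M' (int p + 2 * int k + 1) = w ! (p + 2 * k + 1)"
      using holds_nth[OF M', of "p + 2 * k"] holds_nth[OF M', of "p + 2 * k + 1"]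
      by (simp_all add: nth_append add_ac)
    have bd: "\<bar>w ! (p + 2 * k)\<bar> \<le> Y" "\<bar>w ! (p + 2 * k + 1)\<bar> \<le> Y" "int p + 2 * int k + 1 \<le> Y"
      using nth_le[of "p + 2 * k"] nth_le[of "p + 2 * k + 1"] length_le p k by auto
    have le: "\<bar>w ! (p + 2 * k)\<bar> \<le> b" "\<bar>w ! (p + 2 * k + 1)\<bar> \<le> b" "\<bar>f\<bar> \<le> b"
      "int p + 2 * int k + 1 \<le> b" "\<bar>w ! (p + 2 * k) * f\<bar> \<le> b"
      "int (length w) + int (length v) + 2 * int k + 1 \<le> b" "1 \<le> b" "int m \<le> b"
      using mult_le_b[OF bd(1) f] bd f out k b_ge Y_ge by auto
    have upd: "R' 23 = 1" "R' 12 = f" "R' 10 = int (length w) + int (length v) + 2 * int k"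
      "R' 11 = int p + 2 * int k" "R' 14 = int i" "i \<le> m"
      using regs R by auto
    show ?thesis
      apply (insert upd ld le)
      apply (intro runs_intros)
               apply simp_all
      apply (rule runs_emit[OF M'])
             apply simp_all
      apply (intro runs_intros)
        apply simp_all
      using regs \<open>0 < i\<close>
      apply (auto simp: I_def k(1)[simplified] scaled_rats_Suc mult.commute)
      done
  qed
  show ?thesis
    unfolding copy_column_def
    apply (intro runs_intros)
    using R b_ge Y_ge
      apply (simp_all)[2]
    apply (rule runs_weaken[OF runs_WhilePos[where I = I and N = m and K = 10]])
       apply (use R M in \<open>simp add: I_def scaled_rats_def\<close>)
      apply (use b_ge Y_ge in \<open>auto simp add: I_def\<close>)[]
     apply (use body in \<open>auto simp: I_def\<close>)[]
    apply (auto simp: I_def)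
    done
qed

lemma runs_copy_basis:
  assumes R: "R 23 = 1" "R 9 = 0" "R 2 = int m" "R 7 = int q" "R 16 = int (n - i)"
      "R 15 = int n" "R 11 = 4" "R 10 = int (length w + length v)"
    and M: "holds M (w @ v)" and i: "i < n"
    and out: "int (length w + length v + 2 * (m + 1) * n) \<le> b"
  shows "runs Q b copy_basis R M (\<lambda>k R' M'. k \<le> n * (11 * m + 13) + 1 \<and>
    holds M' (w @ v @ cvp_columns w m q i n) \<and>
    R' 10 = int (length w + length v + 2 * (m + 1) * n) \<and>
    (\<forall>r. r \<notin> {10, 11, 12, 13, 14, 15, 22} \<longrightarrow> R' r = R r))"
proof -
  define I where "I x R' M' \<longleftrightarrow> x \<le> n \<and> R' 15 = int x \<and>
    holds M' (w @ v @ cvp_columns w m q i (n - x)) \<and>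
    R' 10 = int (length w + length v + 2 * (m + 1) * (n - x)) \<and>
    R' 11 = int (4 + 2 * m * (n - x)) \<and>
    (\<forall>r. r \<notin> {10, 11, 12, 13, 14, 15, 22} \<longrightarrow> R' r = R r)"
    for x and R' :: "reg \<Rightarrow> int" and M'
  have body: "runs Q b (select_factor ;; copy_column ;; emit 9 23 ;; Arith Sub 15 15 23) R' M'
      (\<lambda>k R' M'. k \<le> 11 * m + 12 \<and> I (x - 1) R' M')"
    if I: "I x R' M'" "0 < x" for x R' M'
  proof -
    define c where "c = n - x"
    have c: "n - (x - 1) = Suc c" "c < n" "x = n - c" using I by (auto simp: I_def c_def)
    note regs = I(1)[unfolded I_def, folded c_def]
    define f where "f = (if c = i then int q else 1)"
    have f: "\<bar>f\<bar> \<le> Y" using q_le Y_ge by (simp add: f_def)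
    have upd: "R' 23 = 1" "R' 2 = int m" "R' 9 = 0" "R' 7 = int q" "R' 16 = int (n - i)" "R' 15 = int x"
      using regs R by auto
    have le: "int n \<le> b" "int q \<le> b" "1 \<le> b" using b_ge Y_ge q_le by auto
    have "2 * (m + 1) * Suc c \<le> 2 * (m + 1) * n" using c by (intro mult_le_mono2) simp
    then have out': "int (length w + length v + 2 * (m + 1) * Suc c) \<le> b" using out by linarith
    have "m * Suc c \<le> m * n" using c by (intro mult_le_mono2) simp
    \<comment> \<open>The column to be copied lies entirely within the input.\<close>
    then have inp: "4 + 2 * m * c + 2 * m \<le> length w" by (simp add: len_w)
    have sel: "runs Q b select_factor R' M' (\<lambda>k R'' M''. k \<le> 5 \<and> M'' = M' \<and> R'' 12 = f \<and>
        (\<forall>r. r \<notin> {12, 13} \<longrightarrow> R'' r = R' r))"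
      unfolding select_factor_def
      apply (intro runs_intros)
      using upd le i c by (auto simp: f_def)
    show ?thesis
    proof (rule runs_SeqI[OF sel], elim conjE)
      fix k1 :: nat and R1 :: "reg \<Rightarrow> int" and M1 :: "int \<Rightarrow> int"
      assume k1: "k1 \<le> 5" and M1: "M1 = M'" and R1: "R1 12 = f" "\<forall>r. r \<notin> {12, 13} \<longrightarrow> R1 r = R' r"
      show "runs Q b (copy_column ;; emit 9 23 ;; Arith Sub 15 15 23) R1 M1
          (\<lambda>k' R' M'. k1 + k' \<le> 11 * m + 12 \<and> I (x - 1) R' M')"
      proof (rule runs_SeqI[OF runs_copy_column[where p = "4 + 2 * m * c" and f = f and
              v = "v @ cvp_columns w m q i c"]], goal_cases)
        case (11 k2 R2 M2)
        then have M2: "holds M2 (w @ v @ cvp_columns w m q i c @ scaled_rats w (4 + 2 * m * c) f m)"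
          and R2: "R2 10 = int (length w + length v + 2 * (m + 1) * c + 2 * m)"
            "R2 11 = int (4 + 2 * m * Suc c)" "\<forall>r. r \<notin> {10, 11, 13, 14, 22} \<longrightarrow> R2 r = R1 r"
          and k2: "k2 \<le> 11 * m + 2"
          by (simp_all add: algebra_simps)
        have upd2: "R2 23 = 1" "R2 9 = 0" "R2 15 = int x" using R2 R1 upd by simp_all
        show ?case
          apply (rule runs_Seq, rule runs_emit[OF M2])
          using upd2 R2(1) le out' apply (simp_all add: algebra_simps)
          apply (intro runs_intros)
          using upd2 c le apply (simp_all add: I_def)
          using k1 k2 c R1 R2 regs apply (simp_all add: cvp_columns_Suc f_def algebra_simps)
          done
      qed (use M1 R1 upd regs f inp out' in \<open>simp_all add: algebra_simps\<close>)
    qed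
  qed
  show ?thesis
    unfolding copy_basis_def
    apply (rule runs_weaken[OF runs_WhilePos[where I = I and N = n and K = "11 * m + 12"]])
       apply (use R M in \<open>simp add: I_def cvp_columns_def\<close>)
      apply (use b_ge Y_ge in \<open>auto simp add: I_def\<close>)[]
     apply (use body in \<open>auto simp: I_def\<close>)[]
    apply (auto simp: I_def algebra_simps)
    done
qed

definition param_regs :: "(reg \<Rightarrow> int) \<Rightarrow> bool" where
  "param_regs R \<longleftrightarrow> R 0 = int (length w) \<and> R 2 = int m \<and> R 3 = int n \<and> R 4 = w ! 2 \<and>
     R 5 = w ! 3 * int n \<and> R 6 = w ! 2 * (int n + 1) \<and> R 7 = int q \<and> R 8 = int m + 1 \<and>
     R 9 = 0 \<and> R 23 = 1"

lemma param_bounds: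
  "\<bar>w ! 2\<bar> \<le> b" "\<bar>w ! 3 * int n\<bar> \<le> b" "\<bar>w ! 2 * (int n + 1)\<bar> \<le> b" "\<bar>int m + 1\<bar> \<le> b"
  "int n \<le> b" "int q \<le> b" "1 \<le> b" "int (length w) \<le> b"
proof -
  have "\<bar>w ! 2\<bar> \<le> Y" "\<bar>w ! 3\<bar> \<le> Y" using nth_le mn_le by simp_all
  then show "\<bar>w ! 2\<bar> \<le> b" "\<bar>w ! 3 * int n\<bar> \<le> b" "\<bar>w ! 2 * (int n + 1)\<bar> \<le> b" "\<bar>int m + 1\<bar> \<le> b"
    "int n \<le> b" "int q \<le> b" "1 \<le> b" "int (length w) \<le> b"
    using Y_ge b_ge q_le length_le by (auto intro!: mult_le_b)
qed

lemma column_position: "i < n \<Longrightarrow> 4 + 2 * m * i + 2 * m \<le> length w"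
  using mult_le_mono2[of "Suc i" n m] by (simp add: len_w)

lemma scaled_rats_bound:
  assumes "z \<in> set (scaled_rats w p f m)" "p + 2 * m \<le> length w" "\<bar>f\<bar> \<le> Y"
  shows "\<bar>z\<bar> \<le> b"
proof -
  obtain r where r: "r < m" and z: "z = f * w ! (p + 2 * r) \<or> z = w ! (p + 2 * r + 1)"
    using assms(1) by (auto simp: scaled_rats_def)
  have "\<bar>w ! (p + 2 * r)\<bar> \<le> Y" "\<bar>w ! (p + 2 * r + 1)\<bar> \<le> Y"
    using nth_le[of "p + 2 * r"] nth_le[of "p + 2 * r + 1"] r assms(2) by simp_all
  then show ?thesis using z mult_le_b[OF assms(3)] b_ge Y_ge by auto
qed

text \<open>Needed for the price of a query, which depends on the size of every letter.\<close>

lemma cvp_word_bound: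
  assumes z: "z \<in> set (cvp_word w m n q i j)" and i: "i < n" and j: "j < q"
  shows "\<bar>z\<bar> \<le> b"
proof -
  have f: "\<bar>int j\<bar> \<le> Y" "\<bar>if c = i then int q else 1\<bar> \<le> Y" for c
    using q_le j Y_ge by simp_all
  consider "z \<in> {int m + 1, int n, w ! 2 * (int n + 1), w ! 3 * int n, w ! 2, 0, 1}"
    | "z \<in> set (scaled_rats w (4 + 2 * m * i) (int j) m)"
    | c where "c < n" "z \<in> set (scaled_rats w (4 + 2 * m * c) (if c = i then int q else 1) m)"
    using z by (auto simp: cvp_word_def cvp_columns_def split: if_splits)
  then show ?thesis
  proof cases
    case 1
    then show ?thesis using param_bounds by auto
  qed (use scaled_rats_bound f column_position i in blast)+
qed

lemma runs_build_query:
  assumes pr: "param_regs R" and R: "R 16 = int (n - i)" "R 17 = int (4 + 2 * m * i)" "R 18 = int j"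
    and M: "holds M w" and i: "i < n" and j: "j < q"
  shows "runs Q b build_query R M (\<lambda>k R' M'. k \<le> (n + 1) * (11 * m + 20) \<and>
    holds M' (w @ cvp_word w m n q i j) \<and>
    R' 10 = int (length w + (4 + 2 * (m + 1) * (n + 1))) \<and>
    (\<forall>r. r \<notin> {10, 11, 12, 13, 14, 15, 22} \<longrightarrow> R' r = R r))"
proof -
  let ?h1 = "[int m + 1, int n]" and ?h2 = "[w ! 2 * (int n + 1), w ! 3 * int n]"
  let ?s = "[w ! 2, w ! 3 * int n]" and ?t = "scaled_rats w (4 + 2 * m * i) (int j) m"
  note pr = pr[unfolded param_regs_def] and bounds = param_bounds
  have pos: "int (4 + 2 * m * i) \<le> b"
    using column_position[OF i] bounds(8) by linarith
  have jY: "\<bar>int j\<bar> \<le> Y" using j q_le by simp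
  have "length w + 8 + 2 * m \<le> length w + 4 + 2 * (m + 1) * (n + 1)"
    using mn_pos by (simp add: algebra_simps)
  then have adr: "int (length w) + 8 + 2 * int m \<le> b"
    using address_le by linarith
  have head: "runs Q b query_head R M (\<lambda>k R' M'. k \<le> 11 \<and> holds M' (w @ ?h1 @ ?h2) \<and>
      R' 10 = int (length w + 4) \<and> R' 11 = int (4 + 2 * m * i) \<and> R' 12 = int j \<and>
      (\<forall>r. r \<notin> {10, 11, 12} \<longrightarrow> R' r = R r))"
    unfolding query_head_def
    apply (rule runs_Seq, rule runs_Arith)
    using pr bounds apply (simp, simp)
    apply (rule runs_Seq, rule runs_emit[OF M])
    using pr bounds adr apply simp_all
    apply (rule runs_Seq, rule runs_emit, assumption)
    using pr bounds adr apply simp_all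
    apply (intro runs_intros)
    using pr bounds R pos jY b_ge Y_ge by simp_all
  show ?thesis
    unfolding build_query_def
  proof (rule runs_SeqI[OF head], elim conjE)
    fix k1 :: nat and R1 :: "reg \<Rightarrow> int" and M1 :: "int \<Rightarrow> int"
    assume k1: "k1 \<le> 11" and M1: "holds M1 (w @ ?h1 @ ?h2)"
      and R1: "R1 10 = int (length w + 4)" "R1 11 = int (4 + 2 * m * i)" "R1 12 = int j"
        "\<forall>r. r \<notin> {10, 11, 12} \<longrightarrow> R1 r = R r"
    show "runs Q b (copy_column ;; emit 4 5 ;; Const 11 4 ;; Arith Add 15 3 9 ;; copy_basis) R1 M1
      (\<lambda>k' R' M'. k1 + k' \<le> (n + 1) * (11 * m + 20) \<and> holds M' (w @ cvp_word w m n q i j) \<and>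
        R' 10 = int (length w + (4 + 2 * (m + 1) * (n + 1))) \<and>
        (\<forall>r. r \<notin> {10, 11, 12, 13, 14, 15, 22} \<longrightarrow> R' r = R r))"
    proof (rule runs_SeqI[OF runs_copy_column[where p = "4 + 2 * m * i" and f = "int j" and
          v = "?h1 @ ?h2"]], goal_cases)
      case (11 k2 R2 M2)
      then have k2: "k2 \<le> 11 * m + 2" and M2: "holds M2 (w @ ?h1 @ ?h2 @ ?t)"
        and R2: "R2 10 = int (length w) + 4 + 2 * int m"
          "\<forall>r. r \<notin> {10, 11, 13, 14, 22} \<longrightarrow> R2 r = R1 r"
        by simp_all
      have upd: "R2 23 = 1" "R2 4 = w ! 2" "R2 5 = w ! 3 * int n" "R2 3 = int n" "R2 9 = 0"
        "R2 2 = int m" "R2 7 = int q" "R2 16 = int (n - i)"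
        using R2 R1 pr R by auto
      show ?case
      proof (rule runs_Seq, rule runs_emit[OF M2], goal_cases)
        case (8 M3)
        then have M3: "holds M3 (w @ ?h1 @ ?h2 @ ?t @ ?s)" using upd by simp
        show ?case
          apply (rule runs_Seq, rule runs_Const)
          using b_ge Y_ge apply simp
          apply (rule runs_Seq, rule runs_Arith)
          using bounds upd apply (simp, simp)
          apply (rule runs_weaken[OF runs_copy_basis[OF _ _ _ _ _ _ _ _ M3 i]])
                  apply (use upd address_le in \<open>simp_all add: algebra_simps\<close>)
          using k1 k2 R2 R1 apply (simp add: cvp_word_def algebra_simps)
          done
      qed (use upd R2 bounds adr in simp_all)
    qed (use M1 R1 pr jY adr column_position[OF i] in simp_all)
  qed
qed

section \<open>The loops over the multiples \<open>j\<close> and the columns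
  \<open>i\<close>\<close>

lemma param_regs_cong:
  "\<forall>r. r \<notin> {10, 11, 12, 13, 14, 15, 16, 17, 18, 19, 20, 22} \<longrightarrow> R' r = R r \<Longrightarrow>
    param_regs R' \<longleftrightarrow> param_regs R"
  by (simp add: param_regs_def)

lemma runs_try_multiples:
  assumes pr: "param_regs R" and q: "q = 2 * h"
    and R: "R 16 = int (n - i)" "R 17 = int (4 + 2 * m * i)" "R 18 = int q - 1" "R 19 \<in> {0, 1}"
    and M: "holds M w" and i: "i < n"
  shows "runs Q b try_multiples R M (\<lambda>k R' M'. k \<le> q * (query_steps m n + 1) + 1 \<and> holds M' w \<and>
    R' 19 \<in> {0, 1} \<and>
    (R' 19 = 1 \<longleftrightarrow> R 19 = 1 \<or> (\<exists>y < h. Q (cvp_word w m n q i (2 * y + 1)))) \<and>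
    (\<forall>r. r \<notin> {10, 11, 12, 13, 14, 15, 18, 19, 20, 22} \<longrightarrow> R' r = R r))"
proof -
  \<comment> \<open>With \<open>x\<close> odd factors left, the next one is
    \<open>2 * x - 1\<close>. The loop ends with -1 in register 18, which forces
    \<open>x = 0\<close>. Register 19 keeps positive answers from earlier columns.\<close>
  define I where "I x R' M' \<longleftrightarrow> x \<le> h \<and> R' 18 = 2 * int x - 1 \<and> holds M' w \<and> R' 19 \<in> {0, 1} \<and>
    (R' 19 = 1 \<longleftrightarrow> R 19 = 1 \<or> (\<exists>y. x \<le> y \<and> y < h \<and> Q (cvp_word w m n q i (2 * y + 1)))) \<and>
    (\<forall>r. r \<notin> {10, 11, 12, 13, 14, 15, 18, 19, 20, 22} \<longrightarrow> R' r = R r)"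
    for x and R' :: "reg \<Rightarrow> int" and M'
  note bounds = param_bounds
  have body: "runs Q b (build_query ;; Arith Sub 20 10 0 ;; Query 13 0 20 ;;
      IfPos 13 (Const 19 1) Skip ;; Arith Sub 18 18 23 ;; Arith Sub 18 18 23) R' M'
      (\<lambda>k R' M'. k \<le> query_steps m n \<and> I y R' M')"
    if I: "I (Suc y) R' M'" for y R' M'
  proof -
    note regs = I[unfolded I_def]
    let ?u = "cvp_word w m n q i (2 * y + 1)"
    have pr': "param_regs R'" using param_regs_cong[of R' R] regs pr by simp
    have j: "2 * y + 1 < q" using regs q by simp
    have "R' 16 = int (n - i)" "R' 17 = int (4 + 2 * m * i)" "R' 18 = int (2 * y + 1)"
      using regs R by simp_all
    note build = runs_build_query[OF pr' this _ i j]
    have pr'': "R' 0 = int (length w)" "R' 23 = 1"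
      using pr' by (simp_all add: param_regs_def)
    have step: "(\<exists>y'. y \<le> y' \<and> y' < h \<and> Q (cvp_word w m n q i (Suc (2 * y')))) \<longleftrightarrow>
        Q (cvp_word w m n q i (Suc (2 * y))) \<or>
        (\<exists>y'. Suc y \<le> y' \<and> y' < h \<and> Q (cvp_word w m n q i (Suc (2 * y'))))"
      using j q by (metis Suc_leI Suc_leD le_eq_less_or_eq regs Suc_le_lessD)
    show ?thesis
    proof (rule runs_SeqI[OF build], use regs in simp, elim conjE)
      fix k1 :: nat and R1 :: "reg \<Rightarrow> int" and M1 :: "int \<Rightarrow> int"
      assume k1: "k1 \<le> (n + 1) * (11 * m + 20)" and M1: "holds M1 (w @ ?u)"
        and R1: "R1 10 = int (length w + (4 + 2 * (m + 1) * (n + 1)))"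
          "\<forall>r. r \<notin> {10, 11, 12, 13, 14, 15, 22} \<longrightarrow> R1 r = R' r"
      have upd: "R1 0 = int (length w)" "R1 23 = 1" "R1 18 = 2 * int y + 1"
        using R1 pr'' regs by simp_all
      have len: "R1 10 - int (length w) = int (length ?u)" using R1 by simp
      have out: "\<bar>R1 10\<bar> \<le> b" "int (length ?u) \<le> b" using R1 address_le by simp_all
      have yb: "2 * int y + 1 \<le> b" using j bounds(6) by linarith
      show "runs Q b (Arith Sub 20 10 0 ;; Query 13 0 20 ;;
          IfPos 13 (Const 19 1) Skip ;; Arith Sub 18 18 23 ;; Arith Sub 18 18 23) R1 M1
          (\<lambda>k' R' M'. k1 + k' \<le> query_steps m n \<and> I y R' M')"
        apply (rule runs_Seq, rule runs_Arith)
        using out upd bounds apply (simp, simp)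
        apply (rule runs_Seq, rule runs_Query[where w = ?u])
        using upd len out bounds holds_read_word[OF M1] cvp_word_bound[OF _ i j] apply (simp_all del: length_cvp_word)
        apply (intro conjI impI runs_intros)
                           apply (use upd bounds yb in simp_all)
           apply (use k1 regs R1 holds_appendD[OF M1] step in \<open>auto simp: I_def query_steps_def\<close>)
        done
    qed
  qed
  have *: "runs Q b try_multiples R M (\<lambda>k R' M'. k \<le> h * (query_steps m n + 1) + 1 \<and>
      (\<exists>x. I x R' M' \<and> \<not> R' 18 > 0))"
    unfolding try_multiples_def
  proof (intro runs_WhilePos)
    show "I h R M" using R M q by (auto simp: I_def)
  next
    fix x R' M' assume "I x R' M'" and "R' 18 > 0"
    then show "0 < x \<and> runs Q b (build_query ;; Arith Sub 20 10 0 ;; Query 13 0 20 ;;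
      IfPos 13 (Const 19 1) Skip ;; Arith Sub 18 18 23 ;; Arith Sub 18 18 23) R' M'
      (\<lambda>k R' M'. k \<le> query_steps m n \<and> I (x - 1) R' M')"
      using body[of "x - 1" R' M'] by (cases x) (auto simp: I_def)
  next
    fix x R' M' assume "I x R' M'"
    then have "x \<le> h" "R' 18 = 2 * int x - 1" by (simp_all add: I_def)
    then show "\<bar>R' 18\<bar> \<le> b" using bounds(6,7) q by linarith
  qed
  have "h * (query_steps m n + 1) \<le> q * (query_steps m n + 1)" unfolding q by simp
  with * show ?thesis
    by (elim runs_weaken) (auto simp: I_def)
qed

lemma runs_try_columns:
  assumes pr: "param_regs R" and q: "q = 2 * h"
    and R: "R 16 = int n" "R 17 = 4" "R 19 = 0" and M: "holds M w"
  shows "runs Q b try_columns R M (\<lambda>k R' M'. k \<le> n * (q * (query_steps m n + 1) + 6) + 1 \<and>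
    param_regs R' \<and> R' 19 \<in> {0, 1} \<and>
    (R' 19 = 1 \<longleftrightarrow> (\<exists>i < n. \<exists>y < h. Q (cvp_word w m n q i (2 * y + 1)))))"
proof -
  define I where "I x R' M' \<longleftrightarrow> x \<le> n \<and> R' 16 = int x \<and> R' 17 = int (4 + 2 * m * (n - x)) \<and>
    param_regs R' \<and> holds M' w \<and> R' 19 \<in> {0, 1} \<and>
    (R' 19 = 1 \<longleftrightarrow> (\<exists>i < n - x. \<exists>y < h. Q (cvp_word w m n q i (2 * y + 1))))"
    for x and R' :: "reg \<Rightarrow> int" and M'
  note bounds = param_bounds
  have body: "runs Q b (Arith Sub 18 7 23 ;; try_multiples ;;
      Arith Add 17 17 2 ;; Arith Add 17 17 2 ;; Arith Sub 16 16 23) R' M'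
      (\<lambda>k R' M'. k \<le> q * (query_steps m n + 1) + 5 \<and> I x R' M')"
    if I: "I (Suc x) R' M'" for x R' M'
  proof -
    define i where "i = n - Suc x"
    note regs = I[unfolded I_def, folded i_def]
    have i: "i < n" "n - x = Suc i" "Suc x = n - i" using regs by (auto simp: i_def)
    have pos: "int (4 + 2 * m * i + 2 * m) \<le> b" using column_position[OF i(1)] bounds(8) by linarith
    have pr': "R' 7 = int q" "R' 23 = 1" "R' 2 = int m" using regs by (auto simp: param_regs_def)
    have "runs Q b try_multiples (R'(18 := int q - 1)) M' (\<lambda>k R'' M''.
        k \<le> q * (query_steps m n + 1) + 1 \<and> holds M'' w \<and> R'' 19 \<in> {0, 1} \<and>
        (R'' 19 = 1 \<longleftrightarrow> R' 19 = 1 \<or> (\<exists>y < h. Q (cvp_word w m n q i (2 * y + 1)))) \<and>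
        (\<forall>r. r \<notin> {10, 11, 12, 13, 14, 15, 18, 19, 20, 22} \<longrightarrow> R'' r = R' r))"
      by (rule runs_weaken[OF runs_try_multiples[OF _ q]])
        (use regs i param_regs_cong[of "R'(18 := int q - 1)" R'] in auto)
    note inner = this
    have step: "(\<exists>i' < n - x. \<exists>y < h. Q (cvp_word w m n q i' (2 * y + 1))) \<longleftrightarrow>
        (\<exists>i' < i. \<exists>y < h. Q (cvp_word w m n q i' (2 * y + 1))) \<or>
        (\<exists>y < h. Q (cvp_word w m n q i (2 * y + 1)))"
      unfolding i(2) by (metis less_Suc_eq)
    have rest: "runs Q b (Arith Add 17 17 2 ;; Arith Add 17 17 2 ;; Arith Sub 16 16 23) R1 M1
        (\<lambda>k R' M'. k1 + k \<le> q * (query_steps m n + 1) + 4 \<and> I x R' M')"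
      if k1: "k1 \<le> q * (query_steps m n + 1) + 1" and M1: "holds M1 w" and R1: "R1 19 \<in> {0, 1}"
        "R1 19 = 1 \<longleftrightarrow> R' 19 = 1 \<or> (\<exists>y < h. Q (cvp_word w m n q i (2 * y + 1)))"
        "\<forall>r. r \<notin> {10, 11, 12, 13, 14, 15, 18, 19, 20, 22} \<longrightarrow> R1 r = R' r"
      for k1 R1 M1
    proof -
      have upd: "R1 17 = 4 + 2 * int m * int i" "R1 2 = int m" "R1 16 = int x + 1" "R1 23 = 1"
        using R1(3) regs pr' by simp_all
      let ?R = "R1(17 := 4 + 2 * int m * int i + int m + int m, 16 := int x)"
      have "param_regs ?R" using regs R1(3) param_regs_cong[of ?R R'] by simp
      moreover have "int (4 + 2 * m * (n - x)) = 4 + 2 * int m * int i + int m + int m"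
        unfolding i(2) by (simp add: algebra_simps)
      moreover have "R1 19 = 1 \<longleftrightarrow> (\<exists>i' < n - x. \<exists>y < h. Q (cvp_word w m n q i' (2 * y + 1)))"
        unfolding step R1(2) using regs by blast
      ultimately have "I x ?R M1"
        unfolding I_def using regs M1 R1(1) by (simp del: of_nat_add of_nat_mult)
      moreover have "\<bar>4 + 2 * int m * int i\<bar> \<le> b" "\<bar>4 + 2 * int m * int i + int m\<bar> \<le> b"
        "\<bar>int x + 1\<bar> \<le> b" "int m \<le> b" "1 \<le> b"
        using pos bounds regs by simp_all
      ultimately show ?thesis
        using upd k1 by (intro runs_intros) simp_all
    qed
    show ?thesis
    proof (rule runs_Seq, rule runs_Arith, goal_cases)
      case 3
      have eq: "apply_op Sub (R' 7) (R' 23) = int q - 1" using pr' by simp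
      show ?case
        unfolding eq by (rule runs_SeqI[OF inner], elim conjE, rule runs_weaken[OF rest]) (assumption+, auto)
    qed (use pr' bounds in simp_all)
  qed
  have *: "runs Q b try_columns R M (\<lambda>k R' M'. k \<le> n * (q * (query_steps m n + 1) + 5 + 1) + 1 \<and>
      (\<exists>x. I x R' M' \<and> \<not> R' 16 > 0))"
    unfolding try_columns_def
  proof (intro runs_WhilePos)
    show "I n R M" using R M pr by (auto simp: I_def)
  next
    fix x R' M' assume "I x R' M'" and "R' 16 > 0"
    then show "0 < x \<and> runs Q b (Arith Sub 18 7 23 ;; try_multiples ;;
      Arith Add 17 17 2 ;; Arith Add 17 17 2 ;; Arith Sub 16 16 23) R' M'
      (\<lambda>k R' M'. k \<le> q * (query_steps m n + 1) + 5 \<and> I (x - 1) R' M')"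
      using body[of "x - 1" R' M'] by (cases x) (auto simp: I_def)
  next
    fix x R' M' assume "I x R' M'"
    then have "x \<le> n" "R' 16 = int x" by (simp_all add: I_def)
    then show "\<bar>R' 16\<bar> \<le> b" using bounds(5) by linarith
  qed
  show ?thesis
    by (rule runs_weaken[OF *]) (auto simp: I_def algebra_simps)
qed

end

section \<open>Computing the modulus\<close>

lemma modulus_base_bounds:
  assumes "0 < n"
  shows "n < 2 ^ floorlog 2 n" "2 ^ floorlog 2 n \<le> 2 * n" "0 < floorlog 2 n" "floorlog 2 n \<le> n"
proof -
  show lt: "n < 2 ^ floorlog 2 n" using floorlog_bounds[of n 2] assms by simp
  show pos: "0 < floorlog 2 n"
    using assms lt by (cases "floorlog 2 n") auto
  then show "2 ^ floorlog 2 n \<le> 2 * n"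
    using floorlog_bounds[of n 2] assms by (cases "floorlog 2 n") auto
  show "floorlog 2 n \<le> n" by (rule floorlog_leI) (use less_exp in auto)
qed

lemma runs_power_loop:
  assumes "R 21 = int r" "0 < r" "int r ^ K \<le> b" "int r \<le> b"
  shows "runs Q b (power_loop K) R M (\<lambda>k R' M'. k \<le> K + 1 \<and> M' = M \<and> R' 7 = int (r ^ K) \<and>
    (\<forall>x. x \<noteq> 7 \<longrightarrow> R' x = R x))"
  using assms(3)
proof (induction K)
  case 0
  then show ?case by (auto intro!: runs_intros)
next
  case (Suc K)
  have "int r ^ K \<le> int r ^ Suc K" using assms(2) by (intro power_increasing) auto
  with Suc.prems have K: "int r ^ K \<le> b" by simp
  show ?case
    unfolding power_loop.simps
    by (rule runs_SeqI[OF Suc.IH[OF K]], intro runs_intros) (use assms K in auto)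
qed

lemma (in reduction_run) runs_compute_modulus:
  assumes R: "R 23 = 1" "R 3 = int n" "R 9 = 0" and q: "q = modulus K n"
  shows "runs Q b (compute_modulus K) R M (\<lambda>k R' M'. k \<le> 4 * n + K + 4 \<and> M' = M \<and>
    R' 7 = int q \<and> (\<forall>r. r \<notin> {7, 14, 21} \<longrightarrow> R' r = R r))"
proof -
  define I where "I x R' M' \<longleftrightarrow> x \<le> floorlog 2 n \<and> R' 21 = 2 ^ (floorlog 2 n - x) \<and>
    R' 14 = int n + 1 - R' 21 \<and> M' = M \<and> (\<forall>r. r \<notin> {14, 21} \<longrightarrow> R' r = R r)"
    for x and R' :: "reg \<Rightarrow> int" and M'
  note base = modulus_base_bounds[OF mn_pos(2)]
  have r_le: "(2 :: int) ^ e \<le> 2 * int n" if "e \<le> floorlog 2 n" for e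
  proof -
    have "(2 :: nat) ^ e \<le> 2 ^ floorlog 2 n" using that by (intro power_increasing) auto
    with base(2) have "(2 :: nat) ^ e \<le> 2 * n" by linarith
    then have "int (2 ^ e) \<le> int (2 * n)" by (rule of_nat_mono)
    then show ?thesis by simp
  qed
  have nb: "2 * int n + 4 \<le> b" using mn_le length_le b_ge Y_ge by linarith
  have loop: "runs Q b (WhilePos 14 (Arith Add 21 21 21 ;; Arith Add 14 3 23 ;; Arith Sub 14 14 21))
      (R(21 := 1, 14 := int n)) M (\<lambda>k R' M'. k \<le> floorlog 2 n * (3 + 1) + 1 \<and>
        (\<exists>x. I x R' M' \<and> \<not> R' 14 > 0))"
  proof (rule runs_WhilePos)
    show "I (floorlog 2 n) (R(21 := 1, 14 := int n)) M" by (auto simp: I_def)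
  next
    fix x R' M' assume "I x R' M'"
    then have "R' 21 = 2 ^ (floorlog 2 n - x)" "R' 14 = int n + 1 - R' 21" by (simp_all add: I_def)
    then show "\<bar>R' 14\<bar> \<le> b" using r_le[of "floorlog 2 n - x"] nb zero_less_power[of "2 :: int"]
      by (smt (verit) diff_le_self)
  next
    fix x R' M' assume I: "I x R' M'" and pos: "R' 14 > 0"
    define e where "e = floorlog 2 n - x"
    note regs = I[unfolded I_def, folded e_def]
    have "(2 :: int) ^ e \<le> int n" using regs pos by simp
    then have "(2 :: nat) ^ e \<le> n" by (metis of_nat_le_iff of_nat_numeral of_nat_power)
    have "e < floorlog 2 n"
    proof (rule ccontr)
      assume "\<not> e < floorlog 2 n"
      then have "(2 :: nat) ^ floorlog 2 n \<le> 2 ^ e" by (intro power_increasing) auto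
      with \<open>2 ^ e \<le> n\<close> base(1) show False by linarith
    qed
    then have x: "0 < x" "floorlog 2 n - (x - 1) = Suc e" using regs by (auto simp: e_def)
    have "(2 :: int) ^ e \<le> b" "2 * (2 :: int) ^ e \<le> b" using \<open>2 ^ e \<le> int n\<close> nb by linarith+
    then have "runs Q b (Arith Add 21 21 21 ;; Arith Add 14 3 23 ;; Arith Sub 14 14 21) R' M'
        (\<lambda>k R' M'. k \<le> 3 \<and> I (x - 1) R' M')"
      apply (intro runs_intros)
      using regs R nb x(1) apply (auto simp: I_def x(2)[simplified])
      done
    with x show "0 < x \<and> runs Q b (Arith Add 21 21 21 ;; Arith Add 14 3 23 ;; Arith Sub 14 14 21) R' M'
        (\<lambda>k R' M'. k \<le> 3 \<and> I (x - 1) R' M')" by blast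
  qed
  let ?r = "2 ^ floorlog 2 n :: nat"
  have rb: "int ?r ^ K \<le> b" "int ?r \<le> b"
    using param_bounds(6) r_le[of "floorlog 2 n"] nb by (simp_all add: q modulus_def)
  have rest: "runs Q b (power_loop K) R1 M1 (\<lambda>k R' M'. k1 + k \<le> 4 * n + K + 2 \<and> M' = M \<and>
    R' 7 = int q \<and> (\<forall>r. r \<notin> {7, 14, 21} \<longrightarrow> R' r = R r))"
    if k1: "k1 \<le> floorlog 2 n * (3 + 1) + 1" and I: "\<exists>x. I x R1 M1 \<and> \<not> R1 14 > 0" for k1 R1 M1
  proof -
    obtain x where x: "I x R1 M1" "\<not> R1 14 > 0" using I by blast
    define e where "e = floorlog 2 n - x"
    note regs = x(1)[unfolded I_def, folded e_def]
    have "int n < 2 ^ e" using x(2) regs by simp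
    then have "n < 2 ^ e" by (metis of_nat_less_iff of_nat_numeral of_nat_power)
    \<comment> \<open>The failed test says only \<open>n < 2 ^ e\<close>; the minimality of
      \<open>floorlog\<close> excludes that the loop ran short of the intended power.\<close>
    then have "floorlog 2 n \<le> e" by (intro floorlog_leI) auto
    then have "e = floorlog 2 n" by (simp add: e_def)
    then have "R1 21 = int ?r" using regs by simp
    from runs_power_loop[where r = ?r and R = R1, OF this _ rb]
    show ?thesis
      by (rule runs_weaken) (use regs k1 base(4) in \<open>auto simp: q modulus_def\<close>)
  qed
  show ?thesis
    unfolding compute_modulus_def
  proof (rule runs_Seq, rule runs_Const, goal_cases)
    case 2
    show ?case
    proof (rule runs_Seq, rule runs_Arith, goal_cases)
      case 3
      have eq: "R(21 := 1, 14 := apply_op Add ((R(21 := 1)) 3) ((R(21 := 1)) 9)) = R(21 := 1, 14 := int n)"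
        using R by simp
      show ?case
        unfolding eq by (rule runs_SeqI[OF loop], elim conjE, rule runs_weaken[OF rest]) (assumption+, auto)
    qed (use R nb in simp_all)
  qed (use nb in simp)
qed

lemma (in reduction_run) runs_solve_svp:
  assumes R: "R 0 = int (length w)" "R 23 = 1" "R 2 = int m" "R 3 = int n" "R 9 = 0" "R 19 = 0"
    and M: "holds M w" and q: "q = modulus K n" "q = 2 * h"
  shows "runs Q b (solve_svp K) R M (\<lambda>k R' M'.
    k \<le> 4 * n + K + n * (q * (query_steps m n + 1) + 6) + 15 \<and>
    R' 9 = 0 \<and> R' 19 \<in> {0, 1} \<and>
    (R' 19 = 1 \<longleftrightarrow> (\<exists>i < n. \<exists>y < h. Q (cvp_word w m n q i (2 * y + 1)))))"
proof -
  note bounds = param_bounds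
  have ld: "M 2 = w ! 2" "M 3 = w ! 3"
    using holds_nth[OF M, of 2] holds_nth[OF M, of 3] mn_le by simp_all
  have "\<bar>w ! 3\<bar> \<le> b" "3 \<le> b" using nth_le[of 3] mn_le b_ge Y_ge by simp_all
  have load: "runs Q b load_params R M (\<lambda>k R' M'. k \<le> 8 \<and> M' = M \<and> R' 4 = w ! 2 \<and>
      R' 5 = w ! 3 * int n \<and> R' 6 = w ! 2 * (int n + 1) \<and> R' 8 = int m + 1 \<and>
      (\<forall>r. r \<notin> {4, 5, 6, 8, 13} \<longrightarrow> R' r = R r))"
    unfolding load_params_def
    apply (intro runs_intros)
    using bounds ld \<open>\<bar>w ! 3\<bar> \<le> b\<close> \<open>3 \<le> b\<close> R Y_ge b_ge by simp_all
  have tail: "runs Q b (Const 17 4 ;; Arith Add 16 3 9 ;; try_columns) R' M (\<lambda>k R' M'.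
      k \<le> n * (q * (query_steps m n + 1) + 6) + 3 \<and> R' 9 = 0 \<and> R' 19 \<in> {0, 1} \<and>
      (R' 19 = 1 \<longleftrightarrow> (\<exists>i < n. \<exists>y < h. Q (cvp_word w m n q i (2 * y + 1)))))"
    if "param_regs R'" "R' 19 = 0" for R'
  proof (rule runs_Seq, rule runs_Const, goal_cases)
    case 2
    show ?case
    proof (rule runs_Seq, rule runs_Arith, goal_cases)
      case 3
      let ?R = "R'(17 := 4, 16 := int n)"
      have eq: "R'(17 := 4, 16 := apply_op Add ((R'(17 := 4)) 3) ((R'(17 := 4)) 9)) = ?R"
        using that by (simp add: param_regs_def)
      have "param_regs ?R" using that param_regs_cong[of ?R R'] by simp
      then show ?case
        unfolding eq
        by (rule runs_weaken[OF runs_try_columns[OF _ q(2)]])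
          (use that M in \<open>auto simp: param_regs_def\<close>)
    qed (use that bounds in \<open>simp_all add: param_regs_def\<close>)
  qed (use Y_ge b_ge in simp)
  show ?thesis
    unfolding solve_svp_def
  proof (rule runs_SeqI[OF load], elim conjE)
    fix k1 :: nat and R1 :: "reg \<Rightarrow> int" and M1 :: "int \<Rightarrow> int"
    assume k1: "k1 \<le> 8" and M1: "M1 = M"
      and R1: "R1 4 = w ! 2" "R1 5 = w ! 3 * int n" "R1 6 = w ! 2 * (int n + 1)" "R1 8 = int m + 1"
        "\<forall>r. r \<notin> {4, 5, 6, 8, 13} \<longrightarrow> R1 r = R r"
    have "R1 23 = 1" "R1 3 = int n" "R1 9 = 0" using R1 R by simp_all
    note modulus = runs_compute_modulus[OF this q(1), of M]
    show "runs Q b (compute_modulus K ;; Const 17 4 ;; Arith Add 16 3 9 ;; try_columns) R1 M1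
      (\<lambda>k' R' M'. k1 + k' \<le> 4 * n + K + n * (q * (query_steps m n + 1) + 6) + 15 \<and>
        R' 9 = 0 \<and> R' 19 \<in> {0, 1} \<and>
        (R' 19 = 1 \<longleftrightarrow> (\<exists>i < n. \<exists>y < h. Q (cvp_word w m n q i (2 * y + 1)))))"
      unfolding M1
    proof (rule runs_SeqI[OF modulus], elim conjE)
      fix k2 :: nat and R2 :: "reg \<Rightarrow> int" and M2 :: "int \<Rightarrow> int"
      assume k2: "k2 \<le> 4 * n + K + 4" and M2: "M2 = M" and R2: "R2 7 = int q"
        "\<forall>r. r \<notin> {7, 14, 21} \<longrightarrow> R2 r = R1 r"
      have "param_regs R2" "R2 19 = 0" using R2 R1 R by (simp_all add: param_regs_def)
      from tail[OF this]
      show "runs Q b (Const 17 4 ;; Arith Add 16 3 9 ;; try_columns) R2 M2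
        (\<lambda>k' R' M'. k1 + (k2 + k') \<le> 4 * n + K + n * (q * (query_steps m n + 1) + 6) + 15 \<and>
          R' 9 = 0 \<and> R' 19 \<in> {0, 1} \<and>
          (R' 19 = 1 \<longleftrightarrow> (\<exists>i < n. \<exists>y < h. Q (cvp_word w m n q i (2 * y + 1)))))"
        unfolding M2 by (rule runs_weaken) (use k1 k2 in auto)
    qed
  qed
qed

text \<open>The constant has room for the input check and also exceeds the cost on malformed words,
  so one bound covers both cases.\<close>

definition reduction_steps :: "nat \<Rightarrow> nat \<Rightarrow> nat \<Rightarrow> nat \<Rightarrow> nat" where
  "reduction_steps K m n q = 4 * n + K + n * (q * (query_steps m n + 1) + 6) + 30"

lemma even_modulus: "0 < K \<Longrightarrow> 0 < n \<Longrightarrow> even (modulus K n)"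
  using modulus_base_bounds(3)[of n] by (simp add: modulus_def)

text \<open>A word with \<open>n\<close> columns has more than \<open>2 * n\<close> letters. So for
  fixed \<open>K\<close> the value of \<open>q\<close>, not just its bit length, is polynomial in
  the input size, and a search through all \<open>j < q\<close> is affordable.\<close>

lemma modulus_le:
  assumes "svp_word w m n"
  shows "modulus K n \<le> length w ^ K"
proof -
  have "2 ^ floorlog 2 n \<le> length w"
    using modulus_base_bounds(2)[of n] svp_word_bounds[OF assms] by linarith
  then show ?thesis unfolding modulus_def by (intro power_mono) auto
qed

lemma runs_reduction:
  fixes Y b :: int
  assumes entry: "\<And>z. z \<in> set w \<Longrightarrow> \<bar>z\<bar> \<le> Y" and len: "int (length w) \<le> Y"
    and Y: "4 \<le> Y" "int (length w) ^ K \<le> Y" and b: "10 * (Y * Y) \<le> b" and K: "0 < K"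
    and init: "initial_state w = (R, M)"
  shows "runs Q b (reduction K) R M (\<lambda>k R' M'.
    if \<exists>m n. svp_word w m n
    then \<exists>m n. svp_word w m n \<and> k \<le> reduction_steps K m n (modulus K n) \<and>
      (R' 0 > 0 \<longleftrightarrow> (\<exists>i < n. \<exists>j < modulus K n. odd j \<and> Q (cvp_word w m n (modulus K n) i j)))
    else k \<le> 20)"
    (is "runs Q b _ R M ?P")
proof -
  have R: "R = (\<lambda>_. 0)(0 := int (length w))"
    and M: "M = (\<lambda>a. if 0 \<le> a \<and> a < int (length w) then w ! nat a else 0)"
    using init by (simp_all add: initial_state_def)
  have M_le: "\<bar>M a\<bar> \<le> Y" for a using entry Y by (auto simp: M)
  have holds: "holds M w" by (simp add: holds_def M)
  have "4 * Y \<le> Y * Y" using Y by (intro mult_right_mono) auto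
  then have bY: "40 * Y \<le> b" using b by linarith
  have MM: "\<bar>M 0 * M 1\<bar> \<le> Y * Y"
    unfolding abs_mult using M_le Y by (intro mult_mono) auto
  let ?d = "2 * (M 0 * M 1) + 4 - int (length w)"
  have check: "runs Q b check_input R M (\<lambda>k R' M'. k \<le> 9 \<and> M' = M \<and> R' 2 = M 0 \<and> R' 3 = M 1 \<and>
      R' 14 = ?d \<and> R' 15 = - ?d \<and> R' 23 = 1 \<and> R' 0 = int (length w) \<and> R' 9 = 0 \<and> R' 19 = 0)"
  proof -
    have "\<bar>M 0\<bar> \<le> b" "\<bar>M 1\<bar> \<le> b" "\<bar>M 0 * M 1\<bar> \<le> b" "\<bar>2 * (M 0 * M 1)\<bar> \<le> b" "4 \<le> b"
      "\<bar>2 * (M 0 * M 1) + 4\<bar> \<le> b" "int (length w) \<le> b"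
      using M_le[of 0] M_le[of 1] MM bY b Y len by linarith+
    then show ?thesis
      unfolding check_input_def
      apply (intro runs_intros)
      by (simp_all add: R mult.commute)
  qed
  have d_le: "\<bar>?d\<bar> \<le> b" using MM b Y len bY by linarith
  show ?thesis
    unfolding reduction_def
  proof (rule runs_SeqI[OF check], elim conjE)
    fix k1 :: nat and R1 :: "reg \<Rightarrow> int" and M1 :: "int \<Rightarrow> int"
    assume k1: "k1 \<le> 9" and M1: "M1 = M" and R1: "R1 2 = M 0" "R1 3 = M 1" "R1 14 = ?d" "R1 15 = - ?d"
      "R1 23 = 1" "R1 0 = int (length w)" "R1 9 = 0" "R1 19 = 0"
    show "runs Q b (IfPos 2 (IfPos 3 (IfPos 14 Skip (IfPos 15 Skip (solve_svp K))) Skip) Skip ;;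
        Arith Add 0 19 9) R1 M1 (\<lambda>k'. ?P (k1 + k'))"
    proof (cases "\<exists>m n. svp_word w m n")
      case True
      then obtain m n where w: "svp_word w m n" by blast
      note mn = svp_word_bounds[OF w]
      have "0 < length w" "1 < length w" using mn by linarith+
      then have M01: "M 0 = int m" "M 1 = int n"
        using holds_nth[OF holds, of 0] holds_nth[OF holds, of 1] w by (simp_all add: svp_word_def)
      then have d: "?d = 0" using mn(3) by simp
      define q where "q = modulus K n"
      have "int q \<le> int (length w ^ K)"
        unfolding q_def by (intro of_nat_mono modulus_le[OF w])
      then have q_le: "int q \<le> Y" unfolding of_nat_power using Y by linarith
      obtain h where h: "q = 2 * h" using even_modulus[OF K mn(2)] by (auto simp: q_def elim: evenE)
      interpret reduction_run w m n q Y b Q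
      proof
        show "Y * Y \<le> b" using b Y by (smt (verit) mult_nonneg_nonneg)
      qed (use w q_le entry len b Y bY h in auto)
      have odd_iff: "(\<exists>j < q. odd j \<and> Q (cvp_word w m n q i j)) \<longleftrightarrow>
          (\<exists>y < h. Q (cvp_word w m n q i (2 * y + 1)))" for i
      proof safe
        fix j assume j: "j < q" "odd j" "Q (cvp_word w m n q i j)"
        then obtain y where "j = 2 * y + 1" by (elim oddE)
        with j h show "\<exists>y < h. Q (cvp_word w m n q i (2 * y + 1))" by (intro exI[of _ y]) simp
      next
        fix y assume "y < h" "Q (cvp_word w m n q i (2 * y + 1))"
        then show "\<exists>j < q. odd j \<and> Q (cvp_word w m n q i j)"
          using h by (intro exI[of _ "2 * y + 1"]) auto
      qed
      have "runs Q b (solve_svp K) R1 M (\<lambda>k R' M'. k \<le> reduction_steps K m n q - 15 \<and>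
          R' 9 = 0 \<and> R' 19 \<in> {0, 1} \<and>
          (R' 19 = 1 \<longleftrightarrow> (\<exists>i < n. \<exists>j < q. odd j \<and> Q (cvp_word w m n q i j))))"
        unfolding odd_iff
        by (rule runs_weaken[OF runs_solve_svp[OF _ _ _ _ _ _ holds q_def h]])
          (use R1 M01 in \<open>auto simp: reduction_steps_def\<close>)
      note solve = this
      have "runs Q b (IfPos 2 (IfPos 3 (IfPos 14 Skip (IfPos 15 Skip (solve_svp K))) Skip) Skip)
          R1 M (\<lambda>k R' M'. k \<le> reduction_steps K m n q - 11 \<and> R' 9 = 0 \<and> R' 19 \<in> {0, 1} \<and>
          (R' 19 = 1 \<longleftrightarrow> (\<exists>i < n. \<exists>j < q. odd j \<and> Q (cvp_word w m n q i j))))"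
        using R1 M01 mn(1,2) d param_bounds
        by (intro runs_IfPos runs_weaken[OF solve]) (auto simp: reduction_steps_def)
      note branch = this
      show ?thesis
        unfolding M1
      proof (rule runs_SeqI[OF branch], elim conjE, rule runs_Arith, goal_cases)
        case (3 k2 R2 M2)
        then have "k1 + (k2 + 1) \<le> reduction_steps K m n q"
          using k1 by (simp add: reduction_steps_def)
        moreover have "apply_op Add (R2 19) (R2 9) > 0 \<longleftrightarrow> R2 19 = 1" using 3 by auto
        ultimately show ?case using True w 3 unfolding q_def by auto
      qed (use param_bounds in auto)
    next
      case False
      have "runs Q b (IfPos 2 (IfPos 3 (IfPos 14 Skip (IfPos 15 Skip (solve_svp K))) Skip) Skip)
          R1 M (\<lambda>k R' M'. k \<le> 5 \<and> R' = R1)"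
      \<comment> \<open>Passing all four tests would make the word an \<open>svp_word\<close>, so
        here the branch with \<open>solve_svp\<close> is never entered.\<close>
      proof (intro runs_IfPos runs_Skip)
        assume "R1 2 > 0" "R1 3 > 0" "\<not> R1 14 > 0" "\<not> R1 15 > 0"
        then have pos: "M 0 > 0" "M 1 > 0" and d: "?d = 0" using R1 by auto
        from pos have "4 < 2 * (M 0 * M 1) + 4" by simp
        with d have "4 \<le> int (length w)" by simp
        then have "w ! 0 = M 0" "w ! 1 = M 1" by (auto simp: M)
        moreover have "int (length w) = int (4 + 2 * nat (M 0) * nat (M 1))" using d pos by simp
        then have "length w = 4 + 2 * nat (M 0) * nat (M 1)" by (simp only: of_nat_eq_iff)
        ultimately have "svp_word w (nat (M 0)) (nat (M 1))" using pos by (simp add: svp_word_def)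
        with False show "runs Q b (solve_svp K) R1 M (\<lambda>k R' M'. Suc (Suc (Suc (Suc k))) \<le> 5 \<and> R' = R1)"
          by blast
      qed (use R1 d_le M_le[of 0] M_le[of 1] bY Y in auto)
      note branch = this
      show ?thesis
        unfolding M1
        by (rule runs_SeqI[OF branch], rule runs_Arith) (use R1 False k1 bY Y in auto)
    qed
  qed
qed

section \<open>Running time\<close>

definition polynomial_fun :: "(nat \<Rightarrow> nat) \<Rightarrow> bool" where
  "polynomial_fun f \<longleftrightarrow> (\<exists>p. \<forall>x. f x = poly p x)"

lemma polynomial_fun_const: "polynomial_fun (\<lambda>_. c)"
  unfolding polynomial_fun_def by (intro exI[of _ "[:c:]"]) simp

lemma polynomial_fun_id: "polynomial_fun (\<lambda>x. x)"
  unfolding polynomial_fun_def by (intro exI[of _ "[:0, 1:]"]) simp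

lemma polynomial_fun_add:
  "polynomial_fun f \<Longrightarrow> polynomial_fun g \<Longrightarrow> polynomial_fun (\<lambda>x. f x + g x)"
  unfolding polynomial_fun_def by (metis poly_add)

lemma polynomial_fun_mult:
  "polynomial_fun f \<Longrightarrow> polynomial_fun g \<Longrightarrow> polynomial_fun (\<lambda>x. f x * g x)"
  unfolding polynomial_fun_def by (metis poly_mult)

lemma polynomial_fun_power: "polynomial_fun f \<Longrightarrow> polynomial_fun (\<lambda>x. f x ^ K)"
  unfolding polynomial_fun_def by (metis poly_power)

lemma length_le_word_size: "length w \<le> word_size w"
proof -
  have "(\<Sum>z\<leftarrow>w. 1) \<le> (\<Sum>z\<leftarrow>w. int_size z)"
    by (intro sum_list_mono) (simp add: int_size_def)
  then show ?thesis by (simp add: word_size_def sum_list_triv)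
qed

lemma abs_le_word_size:
  assumes "z \<in> set w"
  shows "\<bar>z\<bar> \<le> 2 ^ word_size w"
proof -
  have "int_size z \<le> word_size w"
    unfolding word_size_def using assms by (intro member_le_sum_list) auto
  then have "floorlog 2 (nat \<bar>z\<bar>) \<le> word_size w" by (simp add: int_size_def)
  then have "nat \<bar>z\<bar> < 2 ^ word_size w" by (intro floorlog_leD) auto
  then show ?thesis by (simp add: nat_less_iff)
qed

text \<open>For input size \<open>s\<close>, \<open>2 ^ (s + 4 + s ^ K)\<close> serves as
  \<open>Y\<close>, by \<open>x \<le> 2 ^ x\<close> for the length and its \<open>K\<close>-th
  power, and \<open>b\<close> is 16 times its square. Only the exponent of \<open>b\<close> enters
  the running time, so these crude bounds stay polynomial.\<close>

definition bound_exponent :: "nat \<Rightarrow> nat \<Rightarrow> nat" where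
  "bound_exponent K s = 2 * (s + 4 + s ^ K) + 4"

lemma runs_reduction_word_size:
  assumes K: "0 < K" and init: "initial_state w = (R, M)"
  shows "runs Q (2 ^ bound_exponent K (word_size w)) (reduction K) R M (\<lambda>k R' M'.
    if \<exists>m n. svp_word w m n
    then \<exists>m n. svp_word w m n \<and> k \<le> reduction_steps K m n (modulus K n) \<and>
      (R' 0 > 0 \<longleftrightarrow> (\<exists>i < n. \<exists>j < modulus K n. odd j \<and> Q (cvp_word w m n (modulus K n) i j)))
    else k \<le> 20)"
proof -
  define s where "s = word_size w"
  define Y :: int where "Y = 2 ^ (s + 4 + s ^ K)"
  have ge: "2 ^ e \<le> Y" if "e \<le> s + 4 + s ^ K" for e
    unfolding Y_def using that by (intro power_increasing) auto
  have int_le: "int x \<le> 2 ^ x" for x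
    using of_nat_mono[OF less_imp_le[OF less_exp[of x]], where 'a = int] by simp
  show ?thesis
  proof (rule runs_reduction[OF _ _ _ _ _ K init])
    fix z assume "z \<in> set w"
    from abs_le_word_size[OF this] show "\<bar>z\<bar> \<le> Y" using ge[of s] by (simp add: s_def)
  next
    show "int (length w) \<le> Y"
      using length_le_word_size[of w] int_le[of s] ge[of s] unfolding s_def by linarith
    have "length w ^ K \<le> s ^ K" unfolding s_def by (intro power_mono length_le_word_size) simp
    then have "int (length w ^ K) \<le> int (s ^ K)" by (rule of_nat_mono)
    then show "int (length w) ^ K \<le> Y" using int_le[of "s ^ K"] ge[of "s ^ K"] by simp
    show "4 \<le> Y" using ge[of 2] by simp
    have "bound_exponent K s = (s + 4 + s ^ K) + (s + 4 + s ^ K) + 4"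
      by (simp add: bound_exponent_def)
    then have "2 ^ bound_exponent K s = Y * Y * 16"
      unfolding Y_def by (simp only: power_add[of _ _ 4] power_add[of _ "s + 4 + s ^ K"]) simp
    moreover have "0 \<le> Y * Y" by simp
    ultimately show "10 * (Y * Y) \<le> 2 ^ bound_exponent K (word_size w)"
      unfolding s_def[symmetric] by linarith
  qed
qed

lemma reduction_steps_mono:
  assumes "m \<le> m'" "n \<le> n'" "q \<le> q'"
  shows "reduction_steps K m n q \<le> reduction_steps K m' n' q'"
  unfolding reduction_steps_def query_steps_def
  by (intro add_mono mult_mono assms order_refl) auto

lemma poly_time_reduction:
  assumes K: "0 < K"
  shows "poly_time (reduction K)"
proof -
  let ?T = "\<lambda>s. reduction_steps K s s (s ^ K) * (1 + 2 * (bound_exponent K s + 2))"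
  have "polynomial_fun ?T"
    unfolding reduction_steps_def query_steps_def bound_exponent_def
    by (intro polynomial_fun_add polynomial_fun_mult polynomial_fun_power
        polynomial_fun_const polynomial_fun_id)
  then obtain p where p: "\<And>s. ?T s = poly p s" unfolding polynomial_fun_def by blast
  show ?thesis
    unfolding poly_time_def
  proof (intro exI[of _ p] allI)
    fix Q w
    define s where "s = word_size w"
    obtain R M where init: "initial_state w = (R, M)" by fastforce
    obtain T k R' M' where ex: "exec Q (reduction K) (R, M) T (R', M')"
      and T: "T \<le> k * (1 + 2 * int_size (2 ^ bound_exponent K s))"
      and k: "if \<exists>m n. svp_word w m n
        then \<exists>m n. svp_word w m n \<and> k \<le> reduction_steps K m n (modulus K n) \<and>
          (R' 0 > 0 \<longleftrightarrow> (\<exists>i < n. \<exists>j < modulus K n. odd j \<and> Q (cvp_word w m n (modulus K n) i j)))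
        else k \<le> 20"
      using runs_reduction_word_size[OF K init, of Q] unfolding runs_def s_def by blast
    have "k \<le> reduction_steps K s s (s ^ K)"
    proof (cases "\<exists>m n. svp_word w m n")
      case True
      then obtain m n where w: "svp_word w m n" and k: "k \<le> reduction_steps K m n (modulus K n)"
        using k by auto
      have "m \<le> s" "n \<le> s"
        using svp_word_bounds[OF w] length_le_word_size[of w] unfolding s_def by linarith+
      moreover have "modulus K n \<le> s ^ K"
        using modulus_le[OF w, of K] power_mono[OF length_le_word_size[of w], of K]
        by (simp add: s_def)
      ultimately show ?thesis using k reduction_steps_mono order_trans by blast
    next
      case False
      with k have "k \<le> 20" by simp
      then show ?thesis by (simp add: reduction_steps_def)
    qed
    moreover have "int_size (2 ^ bound_exponent K s) = bound_exponent K s + 2"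
    proof -
      have "nat \<bar>2 ^ bound_exponent K s\<bar> = 1 * 2 ^ bound_exponent K s" by (simp add: nat_power_eq)
      then show ?thesis
        unfolding int_size_def by (simp only: floorlog_power) (simp add: floorlog_def)
    qed
    ultimately have "T \<le> ?T s" using T by (simp only:) (meson mult_le_mono1 order_trans)
    then show "\<exists>T s. exec Q (reduction K) (initial_state w) T s \<and> T \<le> poly p (word_size w)"
      using ex init p s_def by auto
  qed
qed

lemma svp_word_unique: "svp_word w m n \<Longrightarrow> svp_word w m' n' \<Longrightarrow> m' = m \<and> n' = n"
  by (simp add: svp_word_def)

text \<open>Acceptance asks for some halting run; by determinism the run already described is the
  only one.\<close>

lemma accepts_reduction:
  assumes K: "0 < K" and w: "svp_word w m n"
  shows "accepts Q (reduction K) w \<longleftrightarrow>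
    (\<exists>i < n. \<exists>j < modulus K n. odd j \<and> Q (cvp_word w m n (modulus K n) i j))"
proof -
  obtain R M where init: "initial_state w = (R, M)" by fastforce
  obtain T R' M' where ex: "exec Q (reduction K) (R, M) T (R', M')"
    and iff: "R' 0 > 0 \<longleftrightarrow>
      (\<exists>i < n. \<exists>j < modulus K n. odd j \<and> Q (cvp_word w m n (modulus K n) i j))"
    using runs_reduction_word_size[OF K init, of Q] w svp_word_unique[OF w]
    unfolding runs_def by (smt (verit))
  have "accepts Q (reduction K) w \<longleftrightarrow> R' 0 > 0"
    unfolding accepts_def init using ex exec_deterministic[OF ex] by auto
  with iff show ?thesis by simp
qed


section \<open>The reduction theorem\<close>

text \<open>Powers of a base that is at least \<open>n + 1 \<ge> 2\<close> absorb everything: the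
  polynomial, the factor \<open>n + 1\<close> and the hidden constant.\<close>

lemma modulus_exceeds_polynomial_factor:
  fixes \<gamma> :: "nat \<Rightarrow> real"
  assumes "\<gamma> \<in> O(\<lambda>n. real n ^ k)"
  obtains K where "0 < K" "\<And>n. 0 < n \<Longrightarrow> \<gamma> n * (real n + 1) < real (modulus K n)"
proof -
  obtain c where c: "0 < c" "eventually (\<lambda>n. norm (\<gamma> n) \<le> c * norm (real n ^ k)) sequentially"
    using assms by (elim landau_o.bigE)
  then obtain N where N: "\<And>n. N \<le> n \<Longrightarrow> norm (\<gamma> n) \<le> c * norm (real n ^ k)"
    by (auto simp: eventually_sequentially)
  \<comment> \<open>The growth bound holds only from \<open>N\<close> on; the finitely many earlier
    values go into the constant, as \<open>n ^ k\<close> is at least 1 for positive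
    \<open>n\<close>.\<close>
  define C where "C = c + (\<Sum>n < N. \<bar>\<gamma> n\<bar>)"
  have "0 < C" using c by (simp add: C_def add_pos_nonneg sum_nonneg)
  have C: "\<gamma> n \<le> C * real n ^ k" if "0 < n" for n
  proof (cases "n < N")
    case True
    have "\<gamma> n \<le> \<bar>\<gamma> n\<bar>" by simp
    also have "\<dots> \<le> (\<Sum>n < N. \<bar>\<gamma> n\<bar>)" using True by (intro member_le_sum) auto
    also have "\<dots> \<le> C" using c by (simp add: C_def)
    also have "\<dots> \<le> C * real n ^ k"
      using that \<open>0 < C\<close> by (simp add: mult_le_cancel_left1)
    finally show ?thesis .
  next
    case False
    have "\<gamma> n \<le> c * real n ^ k" using N[of n] False by simp
    also have "\<dots> \<le> C * real n ^ k" by (intro mult_right_mono) (auto simp: C_def sum_nonneg)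
    finally show ?thesis .
  qed
  obtain e where e: "C < 2 ^ e" using real_arch_pow[of 2 C] by auto
  show thesis
  \<comment> \<open>The exponent is \<open>e\<close> for the constant \<open>C < 2 ^ e\<close>,
    \<open>k\<close> for the polynomial and 1 for the factor \<open>n + 1\<close>.\<close>
  proof (rule that[of "e + k + 1"])
    fix n :: nat assume n: "0 < n"
    have "\<gamma> n * (real n + 1) \<le> C * real n ^ k * (real n + 1)"
      using C[OF n] by (intro mult_right_mono) auto
    also have "\<dots> \<le> C * (real n + 1) ^ k * (real n + 1)"
      using \<open>0 < C\<close> by (intro mult_right_mono mult_left_mono power_mono) auto
    also have "\<dots> = C * (real n + 1) ^ (k + 1)" by simp
    also have "\<dots> < 2 ^ e * (real n + 1) ^ (k + 1)" using e by (intro mult_strict_right_mono) auto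
    also have "\<dots> \<le> (real n + 1) ^ e * (real n + 1) ^ (k + 1)"
      using n by (intro mult_right_mono power_mono) auto
    also have "\<dots> = (real n + 1) ^ (e + k + 1)" by (simp add: power_add)
    also have "\<dots> \<le> real (2 ^ floorlog 2 n) ^ (e + k + 1)"
    proof (rule power_mono)
      have "n + 1 \<le> 2 ^ floorlog 2 n" using modulus_base_bounds(1)[OF n] by simp
      then have "real (n + 1) \<le> real (2 ^ floorlog 2 n)" by (rule of_nat_mono)
      then show "real n + 1 \<le> real (2 ^ floorlog 2 n)" by simp
    qed simp
    also have "\<dots> = real (modulus (e + k + 1) n)" by (simp add: modulus_def)
    finally show "\<gamma> n * (real n + 1) < real (modulus (e + k + 1) n)" .
  qed simp
qed

lemma coprime_odd_modulus: "odd j \<Longrightarrow> coprime j (modulus K n)"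
  unfolding modulus_def
  by (intro coprime_power_right_iff[THEN iffD2] disjI1) (simp add: coprime_right_2_iff_odd)

text \<open>The disjunction of the answers tolerates queries outside the promise: on a YES instance
  one query inside it suffices, and on a NO instance every query is itself a NO instance.\<close>

lemma oracle_solves_reduction:
  fixes \<gamma> :: "nat \<Rightarrow> real"
  assumes ge_1: "\<And>n. n \<ge> 1 \<Longrightarrow> 1 \<le> \<gamma> n"
    and K: "0 < K" "\<And>n. 0 < n \<Longrightarrow> \<gamma> n * (real n + 1) < real (modulus K n)"
    and Q: "oracle_solves Q (GapCVP (\<lambda>n. 1 / \<gamma> n) \<gamma>)"
  shows "oracle_solves (accepts Q (reduction K)) (GapSVP (\<lambda>n. \<gamma> n * (1 + 1 / real n)))"
  unfolding oracle_solves_def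
proof (intro conjI ballI)
  fix w assume "w \<in> yes_instances (GapSVP (\<lambda>n. \<gamma> n * (1 + 1 / real n)))"
  then obtain B d where w: "encodes_svp w B d" and B: "is_lattice_basis B" and d: "0 < d"
    and short: "lambda1 (lattice_of B) \<le> of_rat d"
    by (auto simp: yes_instances_def GapSVP_def)
  define m n q where "m = dim_row B" and "n = dim_col B" and "q = modulus K (dim_col B)"
  have sw: "svp_word w m n" unfolding m_def n_def by (rule encodes_svp_entries[OF w B])
  have n: "0 < n" using B by (simp add: is_lattice_basis_def n_def)
  have q: "even q" "0 < q" using even_modulus[OF K(1) n] by (simp_all add: q_def n_def modulus_def)
  have "0 < d / of_nat n" using d n by simp
  from sparse_target_close[OF B q this short] obtain i j where i: "i < n" and j: "j < q" "odd j"
    and dist: "lattice_dist (sparse_target B i j (d / of_nat n)) (lattice_of (sparse_basis B i q)) \<le>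
      of_rat (d + d / of_nat n)"
    unfolding n_def by blast
  have "cvp_word w m n q i j \<in> yes_instances (GapCVP (\<lambda>n. 1 / \<gamma> n) \<gamma>)"
    unfolding yes_instances_def GapCVP_def fst_conv
  proof (intro CollectI exI conjI)
    show "encodes_cvp (cvp_word w m n q i j) (sparse_basis B i q)
        (sparse_target B i j (d / of_nat n)) (d * (1 + 1 / of_nat n))"
      unfolding m_def n_def using encodes_cvp_word[OF w B] i n_def by blast
    show "is_lattice_basis (sparse_basis B i q)" by (rule is_lattice_basis_sparse_basis[OF B q(2)])
    show "sparse_target B i j (d / of_nat n) \<in> carrier_vec (dim_row (sparse_basis B i q))"
      by (simp add: sparse_target_def extend_vec_def sparse_basis_def)
    show "0 < d * (1 + 1 / of_nat n)" using d by (simp add: add_pos_nonneg)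
    show "lattice_dist (sparse_target B i j (d / of_nat n)) (lattice_of (sparse_basis B i q)) \<le>
        of_rat (d * (1 + 1 / of_nat n))"
      using dist by (simp add: distrib_left)
  qed
  then have "Q (cvp_word w m n q i j)" using Q by (simp add: oracle_solves_def)
  then show "accepts Q (reduction K) w"
    unfolding accepts_reduction[OF K(1) sw] using i j by (auto simp: q_def n_def)
next
  fix w assume "w \<in> no_instances (GapSVP (\<lambda>n. \<gamma> n * (1 + 1 / real n)))"
  then obtain B d where w: "encodes_svp w B d" and B: "is_lattice_basis B" and d: "0 < d"
    and long: "lambda1 (lattice_of B) >
      \<gamma> (dim_col B) * (1 + 1 / real (dim_col B)) * of_rat d"
    by (auto simp: no_instances_def GapSVP_def)
  define m n q where "m = dim_row B" and "n = dim_col B" and "q = modulus K (dim_col B)"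
  define d' where "d' = d * (1 + 1 / of_nat n)"
  have sw: "svp_word w m n" unfolding m_def n_def by (rule encodes_svp_entries[OF w B])
  have n: "0 < n" using B by (simp add: is_lattice_basis_def n_def)
  have q: "0 < q" by (simp add: q_def modulus_def)
  have \<gamma>: "1 \<le> \<gamma> n" using ge_1 n by simp
  have d'_real: "of_rat d' = of_rat d * (1 + 1 / real n)"
    by (simp add: d'_def of_rat_mult of_rat_add of_rat_divide)
  have d': "0 < d'" using d by (simp add: d'_def add_pos_nonneg)
  have s: "0 < d / of_nat n" using d n by simp
  \<comment> \<open>The factor \<open>1 + 1/n\<close> passes from the approximation factor to the
    distance: \<open>\<gamma>'\<close> times \<open>d\<close> equals \<open>\<gamma>\<close> times
    \<open>d'\<close>.\<close>
  have long': "\<gamma> n * of_rat d' < lambda1 (lattice_of B)"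
    using long by (simp add: d'_real n_def mult_ac)
  \<comment> \<open>Here the required size of \<open>q\<close> originates: \<open>d'\<close> is
    \<open>n + 1\<close> times the extra coordinate \<open>d/n\<close>.\<close>
  have big: "\<gamma> n * of_rat d' < of_nat q * of_rat (d / of_nat n)"
  proof -
    have "\<gamma> n * of_rat d' = \<gamma> n * (real n + 1) * of_rat (d / of_nat n)"
      using n by (simp add: d'_real of_rat_divide field_simps)
    also have "\<dots> < of_nat q * of_rat (d / of_nat n)"
      using K(2)[OF n] s by (intro mult_strict_right_mono) (simp_all add: q_def n_def del: of_rat_divide)
    finally show ?thesis .
  qed
  have "\<not> Q (cvp_word w m n q i j)" if i: "i < n" and j: "odd j" for i j
  proof -
    have "cvp_word w m n q i j \<in> no_instances (GapCVP (\<lambda>n. 1 / \<gamma> n) \<gamma>)"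
      unfolding no_instances_def GapCVP_def snd_conv
    proof (intro CollectI exI conjI allI impI)
      have [simp]: "dim_col (sparse_basis B i q) = n" by (simp add: sparse_basis_def n_def)
      show "encodes_cvp (cvp_word w m n q i j) (sparse_basis B i q)
          (sparse_target B i j (d / of_nat n)) d'"
        unfolding m_def n_def d'_def using encodes_cvp_word[OF w B] i n_def by blast
      show "is_lattice_basis (sparse_basis B i q)" by (rule is_lattice_basis_sparse_basis[OF B q])
      show "sparse_target B i j (d / of_nat n) \<in> carrier_vec (dim_row (sparse_basis B i q))"
        by (simp add: sparse_target_def extend_vec_def sparse_basis_def)
      show "0 < d'" by (rule d')
      have "\<gamma> n * of_rat d' < lambda1 (lattice_of (sparse_basis B i q))"
        using long' lambda1_sparse_basis_ge[OF B q, of i] by linarith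
      then show "of_rat d' < 1 / \<gamma> (dim_col (sparse_basis B i q)) *
          lambda1 (lattice_of (sparse_basis B i q))"
        using \<gamma> by (simp add: field_simps)
      fix k :: int assume k: "k \<noteq> 0"
      have "coprime j q" unfolding q_def by (rule coprime_odd_modulus[OF j])
      \<comment> \<open>An infimum inherits lower bounds only weakly, so the strict inequality is
        put in front of this minimum.\<close>
      define b where "b = min (lambda1 (lattice_of B)) (of_nat q * of_rat (d / of_nat n))"
      have "\<gamma> n * of_rat d' < b" using long' big by (simp add: b_def)
      also have "b \<le> lattice_dist (of_int k \<cdot>\<^sub>v sparse_target B i j (d / of_nat n))
          (lattice_of (sparse_basis B i q))"
        by (rule sparse_target_far[OF B _ q \<open>coprime j q\<close> s k]) (use i in \<open>simp_all add: b_def n_def\<close>)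
      finally show "\<gamma> (dim_col (sparse_basis B i q)) * of_rat d' <
          lattice_dist (of_int k \<cdot>\<^sub>v sparse_target B i j (d / of_nat n))
          (lattice_of (sparse_basis B i q))"
        by simp
    qed
    then show ?thesis using Q by (simp add: oracle_solves_def)
  qed
  then show "\<not> accepts Q (reduction K) w"
    unfolding accepts_reduction[OF K(1) sw] by (auto simp: q_def n_def)
qed

theorem theorem4p6:
  fixes \<gamma> :: "nat \<Rightarrow> real"
  assumes ge_1: "\<And>n. n \<ge> 1 \<Longrightarrow> 1 \<le> \<gamma> n"
    and poly_bounded: "\<exists>k :: nat. \<gamma> \<in> O(\<lambda>n. real n ^ k)"
  shows "\<exists>\<gamma>' \<delta> :: nat \<Rightarrow> real.
    \<delta> \<in> o(\<lambda>n. 1) \<and> (\<forall>n. \<gamma>' n = \<gamma> n * (1 + \<delta> n)) \<and>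
    poly_time_reducible (GapSVP \<gamma>') (GapCVP (\<lambda>n. 1 / \<gamma> n) \<gamma>)"
proof (intro exI conjI allI)
  \<comment> \<open>The witness for \<open>\<delta>\<close> is \<open>1/n\<close>, the relative cost
    of the extra coordinate; at \<open>n = 0\<close> division by zero makes it 0.\<close>
  show "(\<lambda>n. 1 / real n) \<in> o(\<lambda>n. 1)"
    by (rule smalloI_tendsto) (use lim_1_over_n[where 'a = real] in simp_all)
  obtain k where "\<gamma> \<in> O(\<lambda>n. real n ^ k)" using poly_bounded by blast
  then obtain K where K: "0 < K" "\<And>n. 0 < n \<Longrightarrow> \<gamma> n * (real n + 1) < real (modulus K n)"
    using modulus_exceeds_polynomial_factor by blast
  show "poly_time_reducible (GapSVP (\<lambda>n. \<gamma> n * (1 + 1 / real n))) (GapCVP (\<lambda>n. 1 / \<gamma> n) \<gamma>)"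
    unfolding poly_time_reducible_def
    using poly_time_reduction[OF K(1)] oracle_solves_reduction[OF ge_1 K] by blast
qed simp

end
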